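(* Consider the linear model with deterministic design matrix $\mathbf{X}=\mathbf{X}_n$ ($n\times p$, $p=p_n$) of rank $r_n$ described in the context, the projection $\boldsymbol{\theta}$ of $\boldsymbol{\beta}$ onto the row space of $\mathbf{X}$, and the ridge regression estimator $\hat{\boldsymbol{\theta}}=(\mathbf{X}'\mathbf{X}+h_n\mathbf{I}_p)^{-1}\mathbf{X}'\mathbf{y}$ with regularization parameter $h_n>0$. Let $\lambda_{1n}$ be the smallest positive eigenvalue of $\mathbf{X}'\mathbf{X}$. Assume that 1. $\lambda_{1n}^{-1}=O(n^{-\eta})$, where $\eta\le 1$ and $\eta$ does not depend on $n$; 2. $\|\boldsymbol{\theta}\|=O(n^{\tau})$, where $\tau<\eta$ and $\tau$ does not depend on $n$. Then, as $n\to\infty$: (i) $E(\mathbf{l}'\hat{\boldsymbol{\theta}}-\mathbf{l}'\boldsymbol{\theta})^2=O(h_n^{-1})+O(h_n^2n^{-2(\eta-\tau)})$ uniformly over $p$-dimensional deterministic vectors $\mathbf{l}$ with $\|\mathbf{l}\|=1$. (ii) $n^{-1}E\|\mathbf{X}\hat{\boldsymbol{\theta}}-\mathbf{X}\boldsymbol{\theta}\|^2=O(r_nn^{-1})+O(h_n^2n^{-(1+\eta-2\tau)})$.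
   Context: Model: for each $n$, $y_i=\mathbf{x}_i'\boldsymbol{\beta}+\varepsilon_i$, $i=1,\ldots,n$, where $\mathbf{x}_i\in\mathbb{R}^p$ are deterministic, $\boldsymbol{\beta}\in\mathbb{R}^p$ is unknown, and $\varepsilon_1,\ldots,\varepsilon_n$ are independent and identically distributed with mean $0$ and variance $\sigma^2$ (with distribution not depending on $n$). $\mathbf{y}=(y_1,\ldots,y_n)'$, and $\mathbf{X}$ is the (nonzero) $n\times p$ matrix with $i$th row $\mathbf{x}_i'$, of rank $r_n$. The dimension $p=p_n$ is a function of $n$ and may exceed $n$; $\boldsymbol{\beta},\mathbf{y},\mathbf{x}_i,\mathbf{X},\boldsymbol{\theta}$ form triangular arrays, with the index $n$ suppressed. Limits and $O(\cdot)$ are as $n\to\infty$. Projection: $\boldsymbol{\theta}$ is the orthogonal projection of $\boldsymbol{\beta}$ onto the row space $\mathcal{R}(\mathbf{X})$ of $\mathbf{X}$; equivalently, if $\mathbf{X}=\mathbf{P}\mathbf{D}\mathbf{Q}'$ is the singular value decomposition with $\mathbf{P}'\mathbf{P}=\mathbf{Q}'\mathbf{Q}=\mathbf{I}_{r_n}$ and $\mathbf{D}$ an $r_n\times r_n$ nonsingular diagonal matrix, then $\boldsymbol{\theta}=\mathbf{Q}\mathbf{Q}'\boldsymbol{\beta}$. $\|\cdot\|$ is the Euclidean norm, $'$ is transpose, $\mathbf{I}_a$ is the identity matrix of order $a$. *)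

theory Defs
  imports
    "HOL-Probability.Probability"
    "HOL-Library.Landau_Symbols"
    "Jordan_Normal_Form.DL_Rank"
    "Jordan_Normal_Form.Char_Poly"
    "Jordan_Normal_Form.Gauss_Jordan_Elimination"
begin

text \<open>
  The dimensions of the design matrices vary with \<open>n\<close>, so vectors and matrices are those of
  \<open>Jordan_Normal_Form\<close>, whose dimensions are values rather than types.
\<close>

definition euclid_norm :: "real Matrix.vec \<Rightarrow> real" where
  "euclid_norm v = sqrt (scalar_prod v v)"

definition is_orthogonal_projection ::
  "real Matrix.vec set \<Rightarrow> real Matrix.vec \<Rightarrow> real Matrix.vec \<Rightarrow> bool" where
  "is_orthogonal_projection W b t \<longleftrightarrow> t \<in> W \<and> (\<forall>w\<in>W. scalar_prod (b - t) w = 0)"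

text \<open>
  Meaningful for nonzero \<open>X\<close> only: for \<open>X = 0\<close> the minimum is taken over the empty set.
\<close>

definition min_pos_eigenvalue_gram :: "real mat \<Rightarrow> real" where
  "min_pos_eigenvalue_gram X = Min {k. eigenvalue (transpose_mat X * X) k \<and> k > 0}"

text \<open>
  The matrix that is inverted is positive definite whenever \<open>h > 0\<close>, so that
  \<open>mat_inverse\<close> does not return \<open>None\<close>.
\<close>

definition ridge_estimator :: "real mat \<Rightarrow> real \<Rightarrow> real Matrix.vec \<Rightarrow> real Matrix.vec" where
  "ridge_estimator X h y =
     the (mat_inverse (transpose_mat X * X + h \<cdot>\<^sub>m 1\<^sub>m (dim_col X))) *\<^sub>v (transpose_mat X *\<^sub>v y)"

text \<open>
  \<open>f n l = O(g n)\<close> uniformly over \<open>l \<in> S n\<close>: neither the constant nor the threshold for \<open>n\<close>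
  depends on \<open>l\<close>.
\<close>

definition uniform_bigo ::
  "(nat \<Rightarrow> 'b set) \<Rightarrow> (nat \<Rightarrow> 'b \<Rightarrow> real) \<Rightarrow> (nat \<Rightarrow> real) \<Rightarrow> bool" where
  "uniform_bigo S f g \<longleftrightarrow>
     (\<exists>C>0. eventually (\<lambda>n. \<forall>l\<in>S n. \<bar>f n l\<bar> \<le> C * \<bar>g n\<bar>) sequentially)"

end

theory Submission
  imports Defs "Jordan_Normal_Form.Gram_Schmidt"
begin

text \<open>
  Put \<open>V = (X' X + h I)\<inverse>\<close>. As \<open>X \<beta> = X \<theta>\<close>, the error of the estimator splits as
  \<open>- h V \<theta> + V X' \<epsilon>\<close>, a deterministic bias plus a centred noise term, so that no cross terms
  appear in the second moments. All quadratic bounds on \<open>V\<close> come from completing a square in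
  \<open>|X V x|\<^sup>2 + h |V x|\<^sup>2 = x \<bullet> V x\<close>. For the bias, \<open>V \<theta>\<close> is orthogonal to the kernel of \<open>X\<close>,
  where \<open>X' X\<close> is bounded below by its smallest positive eigenvalue. The noise part of the
  prediction error is governed by \<open>X V X'\<close>, a symmetric contraction into the
  column space of \<open>X\<close>; its squared Frobenius norm is therefore at most the rank.
\<close>

unbundle no inner_syntax
unbundle no vec_syntax

section \<open>Scalar products of real vectors\<close>

lemma scalar_prod_self_nonneg: "0 \<le> (v :: real Matrix.vec) \<bullet> v"
  by (auto simp: scalar_prod_def intro!: sum_nonneg)

lemma scalar_prod_self_eq_0:
  assumes "(v :: real Matrix.vec) \<in> carrier_vec n" "v \<bullet> v = 0"
  shows "v = 0\<^sub>v n"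
proof (rule eq_vecI)
  fix i assume "i < dim_vec (0\<^sub>v n :: real Matrix.vec)"
  moreover have "\<forall>i\<in>{0..<dim_vec v}. v $ i * v $ i = 0"
    using assms(2) unfolding scalar_prod_def by (subst (asm) sum_nonneg_eq_0_iff) auto
  ultimately show "v $ i = 0\<^sub>v n $ i" using assms(1) by auto
qed (use assms in auto)

lemma scalar_prod_self_sum:
  "v \<in> carrier_vec n \<Longrightarrow> (v :: real Matrix.vec) \<bullet> v = (\<Sum>k<n. (v $ k)\<^sup>2)"
  by (simp add: scalar_prod_def power2_eq_square lessThan_atLeast0)

lemma euclid_norm_sq: "(euclid_norm v)\<^sup>2 = v \<bullet> v"
  by (simp add: euclid_norm_def scalar_prod_self_nonneg)

lemma scalar_prod_self_diff_smult:
  assumes "(a :: real Matrix.vec) \<in> carrier_vec n" "b \<in> carrier_vec n"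
  shows "(a - c \<cdot>\<^sub>v b) \<bullet> (a - c \<cdot>\<^sub>v b) = a \<bullet> a - 2 * c * (a \<bullet> b) + c\<^sup>2 * (b \<bullet> b)"
  using assms comm_scalar_prod[OF assms]
  by (simp add: minus_scalar_prod_distrib[of _ n] scalar_prod_minus_distrib[of _ n] power2_eq_square
      algebra_simps)

lemma scalar_prod_self_add_smult:
  assumes "(a :: real Matrix.vec) \<in> carrier_vec n" "b \<in> carrier_vec n"
  shows "(a + c \<cdot>\<^sub>v b) \<bullet> (a + c \<cdot>\<^sub>v b) = a \<bullet> a + 2 * c * (a \<bullet> b) + c\<^sup>2 * (b \<bullet> b)"
  using assms comm_scalar_prod[OF assms]
  by (simp add: add_scalar_prod_distrib[of _ n] scalar_prod_add_distrib[of _ n] power2_eq_square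
      algebra_simps)

text \<open>Expansion of the nonnegative square of \<open>a - c b\<close>. It stands in for the
  Cauchy-Schwarz inequality: the weight \<open>c\<close> stays free and is fixed at each use, to
  \<open>l \<bullet> v\<close>, \<open>2 * h\<close>, the eigenvalue bound or 1.\<close>

lemma complete_square:
  assumes "(a :: real Matrix.vec) \<in> carrier_vec n" "b \<in> carrier_vec n"
  shows "2 * c * (a \<bullet> b) \<le> a \<bullet> a + c\<^sup>2 * (b \<bullet> b)"
  using scalar_prod_self_nonneg[of "a - c \<cdot>\<^sub>v b"] scalar_prod_self_diff_smult[OF assms, of c] by simp

lemma scalar_prod_unit_sq_le:
  assumes "(l :: real Matrix.vec) \<in> carrier_vec n" "v \<in> carrier_vec n" "l \<bullet> l = 1"
  shows "(l \<bullet> v)\<^sup>2 \<le> v \<bullet> v"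
  using complete_square[OF assms(2,1), of "l \<bullet> v"] comm_scalar_prod[OF assms(1,2)] assms(3)
  by (simp add: power2_eq_square)

text \<open>A quadratic in \<open>t\<close> that vanishes at 0 and is nonnegative everywhere has a
  minimum at 0, so its derivative \<open>2 * b\<close> there is zero. This turns minimality into a
  first-order condition.\<close>

lemma linear_term_eq_0:
  fixes b c :: real
  assumes "\<And>t. 0 \<le> 2 * t * b + t\<^sup>2 * c"
  shows "b = 0"
proof (rule ccontr)
  assume b: "b \<noteq> 0"
  define d where "d = \<bar>c\<bar> + 1"
  have d: "d > 0" "c < d" by (auto simp: d_def)
  \<comment> \<open>At \<open>t = - b / d\<close> the value is
    \<open>b\<^sup>2 * (c - 2 * d) / d\<^sup>2\<close>, negative because \<open>d\<close> exceeds
    both 0 and \<open>c\<close>.\<close>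
  have "0 \<le> 2 * (- b / d) * b + (- b / d)\<^sup>2 * c" by (rule assms)
  hence "0 \<le> (2 * (- b / d) * b + (- b / d)\<^sup>2 * c) * d\<^sup>2" by simp
  also have "\<dots> = b\<^sup>2 * (c - 2 * d)" using d by (simp add: power2_eq_square field_simps)
  also have "\<dots> < 0" using b d by (simp add: mult_pos_neg)
  finally show False by simp
qed

section \<open>The Gram matrix and the orthogonal complement of the kernel\<close>

lemma gram_mult_vec:
  assumes "(X :: real mat) \<in> carrier_mat n p" "x \<in> carrier_vec p"
  shows "(transpose_mat X * X) *\<^sub>v x = transpose_mat X *\<^sub>v (X *\<^sub>v x)"
  using assms by (intro assoc_mult_mat_vec[of _ p n _ p]) auto

lemma gram_form:
  assumes "(X :: real mat) \<in> carrier_mat n p" "x \<in> carrier_vec p" "y \<in> carrier_vec p"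
  shows "((transpose_mat X * X) *\<^sub>v x) \<bullet> y = (X *\<^sub>v x) \<bullet> (X *\<^sub>v y)"
  using assms by (subst gram_mult_vec[OF assms(1,2)], intro transpose_vec_mult_scalar[of _ n p]) auto

text \<open>
  This is the row space, but as an intersection of hyperplanes it is visibly closed, which is
  what the minimization of the Rayleigh quotient needs.
\<close>

definition orth_kernel :: "real mat \<Rightarrow> real Matrix.vec set" where
  "orth_kernel X = {v \<in> carrier_vec (dim_col X).
     \<forall>u\<in>carrier_vec (dim_col X). X *\<^sub>v u = 0\<^sub>v (dim_row X) \<longrightarrow> v \<bullet> u = 0}"

text \<open>A vector \<open>X' z\<close> pairs with \<open>u\<close> as \<open>z\<close> pairs with
  \<open>X u\<close>, which is zero on the kernel. This brings the projection of \<beta> within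
  reach of the eigenvalue bound below.\<close>

lemma row_space_subset_orth_kernel:
  assumes X: "(X :: real mat) \<in> carrier_mat n p"
  shows "vec_space.row_space p X \<subseteq> orth_kernel X"
proof
  fix v assume "v \<in> vec_space.row_space p X"
  then obtain z where z: "z \<in> carrier_vec n" "v = transpose_mat X *\<^sub>v z"
    unfolding vec_space.row_space_eq[OF X] using X by auto
  have "v \<bullet> u = z \<bullet> (X *\<^sub>v u)" if "u \<in> carrier_vec p" for u
    using z transpose_vec_mult_scalar[OF X that z(1)] by simp
  thus "v \<in> orth_kernel X" using z X by (auto simp: orth_kernel_def)
qed

section \<open>The smallest positive eigenvalue as a lower bound for the Rayleigh quotient\<close>

text \<open>Vectors are read as sequences that vanish from index \<open>p\<close> on, in the product
  topology. The cube with sides [-1, 1] is compact there by Tychonoff's theorem, and the set is a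
  closed part of it, since each of its conditions involves only finitely many coordinates.\<close>

lemma compact_unit_sphere_section:
  "compact {f :: nat \<Rightarrow> real. (\<forall>i\<ge>p. f i = 0) \<and> (\<Sum>i<p. (f i)\<^sup>2) = 1 \<and>
     (\<forall>u\<in>K. (\<Sum>i<p. f i * u i) = 0)}" (is "compact ?S")
proof -
  have "compactin (product_topology (\<lambda>_. euclidean) UNIV) (PiE UNIV (\<lambda>_::nat. {-1..1::real}))"
    unfolding compactin_PiE by auto
  hence cube: "compact (PiE UNIV (\<lambda>_::nat. {-1..1::real}))"
    by (simp add: euclidean_product_topology)
  have "closed {f :: nat \<Rightarrow> real. (\<Sum>i<p. (f i)\<^sup>2) = 1}"
    by (rule closed_Collect_eq) (intro continuous_intros continuous_on_product_coordinates)+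
  moreover have "closed {f :: nat \<Rightarrow> real. (\<Sum>i<p. f i * u i) = 0}" for u
    by (rule closed_Collect_eq) (intro continuous_intros continuous_on_product_coordinates)+
  moreover have "closed {f :: nat \<Rightarrow> real. f i = 0}" for i
    by (rule closed_Collect_eq) (intro continuous_on_const continuous_on_product_coordinates)+
  moreover have "?S = (\<Inter>i\<in>{p..}. {f. f i = 0}) \<inter> {f. (\<Sum>i<p. (f i)\<^sup>2) = 1} \<inter>
      (\<Inter>u\<in>K. {f. (\<Sum>i<p. f i * u i) = 0})"
    by auto
  ultimately have closed: "closed ?S"
    by (simp only:) (intro closed_Int closed_INT ballI)
  have "?S \<subseteq> PiE UNIV (\<lambda>_. {-1..1})"
  proof
    fix f assume f: "f \<in> ?S"
    have "f i \<in> {-1..1}" for i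
    proof (cases "i < p")
      case True
      have "(f i)\<^sup>2 \<le> (\<Sum>i<p. (f i)\<^sup>2)" using True by (intro member_le_sum) auto
      hence "(f i)\<^sup>2 \<le> 1" using f by simp
      thus ?thesis by (auto simp: abs_square_le_1 abs_le_iff)
    qed (use f in auto)
    thus "f \<in> PiE UNIV (\<lambda>_. {-1..1})" by auto
  qed
  hence "?S = PiE UNIV (\<lambda>_. {-1..1}) \<inter> ?S" by blast
  thus ?thesis using compact_Int_closed[OF cube closed] by (simp only:)
qed

lemma orth_kernel_add:
  assumes "a \<in> orth_kernel X" "b \<in> orth_kernel X"
  shows "a + c \<cdot>\<^sub>v b \<in> orth_kernel X"
  using assms by (auto simp: orth_kernel_def add_scalar_prod_distrib[of _ "dim_col X"])

text \<open>This makes the residual of the eigenvalue equation an admissible direction of variation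
  at the minimizer.\<close>

lemma gram_in_orth_kernel:
  assumes X: "X \<in> carrier_mat n p" and v: "v \<in> carrier_vec p"
  shows "(transpose_mat X * X) *\<^sub>v v \<in> orth_kernel X"
proof -
  have "((transpose_mat X * X) *\<^sub>v v) \<bullet> u = 0"
    if "u \<in> carrier_vec p" "X *\<^sub>v u = 0\<^sub>v n" for u
    using gram_form[OF X v that(1)] that mult_mat_vec_carrier[OF X v] by simp
  thus ?thesis using X v by (auto simp: orth_kernel_def intro!: mult_mat_vec_carrier[of _ p p])
qed

text \<open>A continuous function attains its infimum on the compact unit sphere of
  \<open>orth_kernel X\<close>, and homogeneity extends the bound to all vectors. The nonzero
  \<open>w\<close> guarantees that the sphere is not empty.\<close>

lemma rayleigh_minimizer_exists:
  assumes X: "X \<in> carrier_mat n p" and w: "w \<in> orth_kernel X" "w \<noteq> 0\<^sub>v p"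
  obtains v where "v \<in> orth_kernel X" "v \<bullet> v = 1"
    "\<And>w. w \<in> orth_kernel X \<Longrightarrow> (X *\<^sub>v v) \<bullet> (X *\<^sub>v v) * (w \<bullet> w) \<le> (X *\<^sub>v w) \<bullet> (X *\<^sub>v w)"
proof -
  define K where "K = (\<lambda>u i. u $ i) ` {u \<in> carrier_vec p. X *\<^sub>v u = 0\<^sub>v n}"
  define S where "S = {f :: nat \<Rightarrow> real. (\<forall>i\<ge>p. f i = 0) \<and> (\<Sum>i<p. (f i)\<^sup>2) = 1 \<and>
     (\<forall>u\<in>K. (\<Sum>i<p. f i * u i) = 0)}"
  define F where "F = (\<lambda>f :: nat \<Rightarrow> real. \<Sum>k<n. (\<Sum>i<p. X $$ (k, i) * f i)\<^sup>2)"
  have compact: "compact S"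
    unfolding S_def by (rule compact_unit_sphere_section)
  have cont: "continuous_on S F"
    unfolding F_def
    by (intro continuous_on_sum continuous_on_mult continuous_on_const continuous_on_power
        continuous_on_subset[OF continuous_on_product_coordinates]) auto
  have F_vec: "F f = (X *\<^sub>v vec p f) \<bullet> (X *\<^sub>v vec p f)" for f
    using X by (simp add: F_def scalar_prod_def power2_eq_square lessThan_atLeast0)
  have S_orth: "vec p f \<in> orth_kernel X" "vec p f \<bullet> vec p f = 1" if "f \<in> S" for f
    using that X
    by (auto simp: S_def K_def orth_kernel_def scalar_prod_def power2_eq_square lessThan_atLeast0)
  \<comment> \<open>The passage back from vectors to sequences: scale to length 1 and pad with zeros
    from index \<open>p\<close> on.\<close>
  define normed where "normed v = (\<lambda>i. if i < p then v $ i / sqrt (v \<bullet> v) else 0)"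
    for v :: "real Matrix.vec"
  have normed_vec: "vec p (normed v) = (1 / sqrt (v \<bullet> v)) \<cdot>\<^sub>v v" if "v \<in> carrier_vec p" for v
    using that by (auto simp: normed_def)
  have normed_S: "normed v \<in> S" and F_normed: "F (normed v) = (X *\<^sub>v v) \<bullet> (X *\<^sub>v v) / (v \<bullet> v)"
    if v: "v \<in> orth_kernel X" "v \<noteq> 0\<^sub>v p" for v
  proof -
    have vp: "v \<in> carrier_vec p" using v X by (auto simp: orth_kernel_def)
    have pos: "v \<bullet> v > 0"
      using scalar_prod_self_eq_0[OF vp] scalar_prod_self_nonneg[of v] v by force
    have "(\<Sum>i<p. (normed v i)\<^sup>2) = vec p (normed v) \<bullet> vec p (normed v)"
      by (simp add: scalar_prod_def power2_eq_square lessThan_atLeast0)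
    also have "\<dots> = 1" using pos vp by (simp add: normed_vec field_simps)
    finally have one: "(\<Sum>i<p. (normed v i)\<^sup>2) = 1" .
    have "(\<Sum>i<p. normed v i * u $ i) = vec p (normed v) \<bullet> u" if "u \<in> carrier_vec p" for u
      using that by (simp add: scalar_prod_def lessThan_atLeast0)
    hence "(\<Sum>i<p. normed v i * u $ i) = 0" if "u \<in> carrier_vec p" "X *\<^sub>v u = 0\<^sub>v n" for u
      using that vp v X by (simp add: normed_vec orth_kernel_def)
    thus "normed v \<in> S" using one by (auto simp: S_def K_def normed_def)
    show "F (normed v) = (X *\<^sub>v v) \<bullet> (X *\<^sub>v v) / (v \<bullet> v)"
      using pos X vp
      by (simp add: F_vec normed_vec mult_mat_vec[OF X] field_simps)
  qed
  have "S \<noteq> {}" using normed_S[OF w] by auto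
  then obtain f where f: "f \<in> S" "\<And>g. g \<in> S \<Longrightarrow> F f \<le> F g"
    using continuous_attains_inf[OF compact _ cont] by auto
  show ?thesis
  proof (rule that[of "vec p f"])
    fix v assume v: "v \<in> orth_kernel X"
    have vp: "v \<in> carrier_vec p" using v X by (auto simp: orth_kernel_def)
    show "(X *\<^sub>v vec p f) \<bullet> (X *\<^sub>v vec p f) * (v \<bullet> v) \<le> (X *\<^sub>v v) \<bullet> (X *\<^sub>v v)"
    proof (cases "v = 0\<^sub>v p")
      case True
      thus ?thesis by (simp add: scalar_prod_self_nonneg)
    next
      case False
      have pos: "v \<bullet> v > 0"
        using scalar_prod_self_eq_0[OF vp] scalar_prod_self_nonneg[of v] False by force
      have "F f \<le> F (normed v)" by (intro f normed_S v False)
      thus ?thesis using pos by (simp add: F_normed[OF v False] F_vec[symmetric] field_simps)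
    qed
  qed (use S_orth[OF f(1)] in auto)
qed

text \<open>
  The first variation of the Rayleigh quotient at its minimizer on the orthogonal complement
  of the kernel is the residual of the eigenvalue equation.
\<close>

lemma gram_eigenvalue_below_rayleigh:
  assumes X: "X \<in> carrier_mat n p" and w: "w \<in> orth_kernel X" "w \<noteq> 0\<^sub>v p"
  obtains \<mu> where "eigenvalue (transpose_mat X * X) \<mu>" "\<mu> > 0"
    "\<And>v. v \<in> orth_kernel X \<Longrightarrow> \<mu> * (v \<bullet> v) \<le> (X *\<^sub>v v) \<bullet> (X *\<^sub>v v)"
proof -
  obtain v where v: "v \<in> orth_kernel X" "v \<bullet> v = 1" and
    min: "\<And>w. w \<in> orth_kernel X \<Longrightarrow> (X *\<^sub>v v) \<bullet> (X *\<^sub>v v) * (w \<bullet> w) \<le> (X *\<^sub>v w) \<bullet> (X *\<^sub>v w)"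
    using rayleigh_minimizer_exists[OF X w] by metis
  define G where "G = transpose_mat X * X"
  define \<mu> where "\<mu> = (X *\<^sub>v v) \<bullet> (X *\<^sub>v v)"
  have G: "G \<in> carrier_mat p p" using X by (auto simp: G_def)
  have vp: "v \<in> carrier_vec p" using v X by (auto simp: orth_kernel_def)
  have Gv: "G *\<^sub>v v \<in> orth_kernel X" unfolding G_def by (rule gram_in_orth_kernel[OF X vp])
  have Gvp: "G *\<^sub>v v \<in> carrier_vec p" using G vp by auto
  have v0: "v \<noteq> 0\<^sub>v p" using v(2) by auto
  define z where "z = G *\<^sub>v v + (- \<mu>) \<cdot>\<^sub>v v"
  have z: "z \<in> orth_kernel X" unfolding z_def by (intro orth_kernel_add Gv v)
  hence zp: "z \<in> carrier_vec p" using X by (auto simp: orth_kernel_def)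
  have Xc: "X *\<^sub>v x \<in> carrier_vec n" if "x \<in> carrier_vec p" for x using X that by auto
  \<comment> \<open>Minimality of \<open>v\<close> compared with \<open>v + t z\<close>. The
    constant terms cancel, as \<open>v \<bullet> v = 1\<close> and \<mu> is the value at
    \<open>v\<close>.\<close>
  have "0 \<le> 2 * t * ((X *\<^sub>v v) \<bullet> (X *\<^sub>v z) - \<mu> * (v \<bullet> z)) +
      t\<^sup>2 * ((X *\<^sub>v z) \<bullet> (X *\<^sub>v z) - \<mu> * (z \<bullet> z))" for t
  proof -
    have "\<mu> * ((v + t \<cdot>\<^sub>v z) \<bullet> (v + t \<cdot>\<^sub>v z)) \<le> (X *\<^sub>v (v + t \<cdot>\<^sub>v z)) \<bullet> (X *\<^sub>v (v + t \<cdot>\<^sub>v z))"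
      unfolding \<mu>_def by (intro min orth_kernel_add v z)
    also have "X *\<^sub>v (v + t \<cdot>\<^sub>v z) = X *\<^sub>v v + t \<cdot>\<^sub>v (X *\<^sub>v z)"
      using X vp zp by (simp add: mult_add_distrib_mat_vec[of _ n p] mult_mat_vec[of _ n p])
    finally show ?thesis
      unfolding scalar_prod_self_add_smult[OF vp zp] scalar_prod_self_add_smult[OF Xc[OF vp] Xc[OF zp]]
      by (simp add: v \<mu>_def[symmetric] algebra_simps)
  qed
  hence "(X *\<^sub>v v) \<bullet> (X *\<^sub>v z) - \<mu> * (v \<bullet> z) = 0" by (rule linear_term_eq_0)
  hence "(G *\<^sub>v v) \<bullet> z - \<mu> * (v \<bullet> z) = 0" by (simp add: G_def gram_form[OF X vp zp])
  \<comment> \<open>With the residual itself as direction, the first variation is the squared length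
    of the residual.\<close>
  moreover have "z \<bullet> z = (G *\<^sub>v v) \<bullet> z - \<mu> * (v \<bullet> z)"
    using Gvp vp zp by (subst z_def) (simp add: add_scalar_prod_distrib[of _ p])
  ultimately have "z = 0\<^sub>v p" by (intro scalar_prod_self_eq_0[OF zp]) simp
  have Gv_eq: "G *\<^sub>v v = \<mu> \<cdot>\<^sub>v v"
  proof (rule eq_vecI)
    fix i assume "i < dim_vec (\<mu> \<cdot>\<^sub>v v)"
    hence i: "i < p" using vp by auto
    have "z $ i = (G *\<^sub>v v) $ i - \<mu> * v $ i" using i vp Gvp by (simp add: z_def)
    thus "(G *\<^sub>v v) $ i = (\<mu> \<cdot>\<^sub>v v) $ i" using \<open>z = 0\<^sub>v p\<close> i vp by simp
  qed (use Gvp vp G in auto)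
  \<comment> \<open>Were \<mu> zero, \<open>v\<close> would lie both in the kernel of
    \<open>X\<close> and in its orthogonal complement.\<close>
  have "\<mu> \<noteq> 0"
  proof
    assume "\<mu> = 0"
    hence "X *\<^sub>v v = 0\<^sub>v n" unfolding \<mu>_def by (intro scalar_prod_self_eq_0[OF Xc[OF vp]])
    hence "v \<bullet> v = 0" using v(1) vp X by (auto simp: orth_kernel_def)
    thus False using v(2) by simp
  qed
  hence "\<mu> > 0" using scalar_prod_self_nonneg[of "X *\<^sub>v v"] by (simp add: \<mu>_def)
  moreover have "eigenvalue G \<mu>"
    using Gv_eq vp v0 G by (auto simp: eigenvalue_def eigenvector_def)
  ultimately show ?thesis using min that unfolding G_def \<mu>_def by blast
qed

text \<open>The set under \<open>Min\<close> is finite, as its members are roots of the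
  characteristic polynomial, and it contains the eigenvalue just found, which bounds the Rayleigh
  quotient from below. The least member is no larger, so the bound holds for it too.\<close>

lemma min_pos_eigenvalue_gram:
  assumes X: "X \<in> carrier_mat n p" "X \<noteq> 0\<^sub>m n p"
  shows min_pos_eigenvalue_gram_pos: "min_pos_eigenvalue_gram X > 0"
    and min_pos_eigenvalue_gram_le: "v \<in> orth_kernel X \<Longrightarrow>
      min_pos_eigenvalue_gram X * (v \<bullet> v) \<le> (X *\<^sub>v v) \<bullet> (X *\<^sub>v v)"
proof -
  define G where "G = transpose_mat X * X"
  define E where "E = {k. eigenvalue G k \<and> k > 0}"
  have G: "G \<in> carrier_mat p p" using X by (auto simp: G_def)
  have "char_poly G \<noteq> 0" using degree_monic_char_poly[OF G] by auto
  hence "finite {k. poly (char_poly G) k = 0}" by (rule poly_roots_finite)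
  hence fin: "finite E"
    by (rule finite_subset[rotated]) (auto simp: E_def eigenvalue_root_char_poly[OF G])
  \<comment> \<open>A nonzero entry of \<open>X\<close> gives a nonzero row, and rows are orthogonal
    to the kernel; this is the nonzero vector that the minimization requires.\<close>
  obtain i j where ij: "i < n" "j < p" "X $$ (i, j) \<noteq> 0"
    using X by (metis carrier_matD eq_matI index_zero_mat)
  have "Matrix.row X i \<in> orth_kernel X"
  proof -
    have "Matrix.row X i \<bullet> u = 0" if "X *\<^sub>v u = 0\<^sub>v n" for u
      using index_mult_mat_vec[of i X u] that ij X by simp
    thus ?thesis using X ij by (auto simp: orth_kernel_def)
  qed
  moreover have "Matrix.row X i \<noteq> 0\<^sub>v p"
    using ij X by (metis carrier_matD index_row(1) index_zero_vec(1))
  ultimately obtain \<mu> where \<mu>: "eigenvalue G \<mu>" "\<mu> > 0"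
    "\<And>v. v \<in> orth_kernel X \<Longrightarrow> \<mu> * (v \<bullet> v) \<le> (X *\<^sub>v v) \<bullet> (X *\<^sub>v v)"
    unfolding G_def using gram_eigenvalue_below_rayleigh[OF X(1)] by metis
  have mem: "\<mu> \<in> E" using \<mu> by (simp add: E_def)
  have eq: "min_pos_eigenvalue_gram X = Min E" by (simp add: min_pos_eigenvalue_gram_def E_def G_def)
  show "min_pos_eigenvalue_gram X > 0"
    unfolding eq using Min_in[OF fin] mem by (auto simp: E_def)
  show "min_pos_eigenvalue_gram X * (v \<bullet> v) \<le> (X *\<^sub>v v) \<bullet> (X *\<^sub>v v)" if v: "v \<in> orth_kernel X"
  proof -
    have "Min E * (v \<bullet> v) \<le> \<mu> * (v \<bullet> v)"
      using Min_le[OF fin mem] scalar_prod_self_nonneg by (intro mult_right_mono) auto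
    thus ?thesis using \<mu>(3)[OF v] eq by simp
  qed
qed

section \<open>The ridge resolvent and its quadratic bounds\<close>

definition ridge_matrix :: "real mat \<Rightarrow> real \<Rightarrow> real mat" where
  "ridge_matrix X h = transpose_mat X * X + h \<cdot>\<^sub>m 1\<^sub>m (dim_col X)"

definition ridge_resolvent :: "real mat \<Rightarrow> real \<Rightarrow> real mat" where
  "ridge_resolvent X h = the (mat_inverse (ridge_matrix X h))"

lemma ridge_estimator_resolvent:
  "ridge_estimator X h y = ridge_resolvent X h *\<^sub>v (transpose_mat X *\<^sub>v y)"
  by (simp add: ridge_estimator_def ridge_resolvent_def ridge_matrix_def)

locale ridge =
  fixes X :: "real mat" and n p :: nat and h :: real
  assumes X: "X \<in> carrier_mat n p" and h: "h > 0"
begin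

abbreviation "R \<equiv> ridge_matrix X h"
abbreviation "V \<equiv> ridge_resolvent X h"

lemma R_carrier: "R \<in> carrier_mat p p"
  using X by (auto simp: ridge_matrix_def)

lemma R_mult_vec:
  assumes "x \<in> carrier_vec p"
  shows "R *\<^sub>v x = transpose_mat X *\<^sub>v (X *\<^sub>v x) + h \<cdot>\<^sub>v x"
proof -
  have "(h \<cdot>\<^sub>m 1\<^sub>m p) *\<^sub>v x = h \<cdot>\<^sub>v x"
    using assms by (intro eq_vecI) auto
  thus ?thesis
    using assms X unfolding ridge_matrix_def
    by (subst add_mult_distrib_mat_vec[of _ p p]) (auto simp: gram_mult_vec[OF X])
qed

lemma R_form:
  assumes x: "x \<in> carrier_vec p" and y: "y \<in> carrier_vec p"
  shows "(R *\<^sub>v x) \<bullet> y = (X *\<^sub>v x) \<bullet> (X *\<^sub>v y) + h * (x \<bullet> y)"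
proof -
  have "transpose_mat X *\<^sub>v (X *\<^sub>v x) \<in> carrier_vec p" using X x by auto
  thus ?thesis
    using gram_form[OF X x y] x y
    by (simp add: R_mult_vec add_scalar_prod_distrib[of _ p] gram_mult_vec[OF X])
qed

text \<open>The form of \<open>R\<close> at \<open>v\<close> is
  \<open>|X v|\<^sup>2 + h |v|\<^sup>2\<close>, a sum of nonnegative terms, so \<open>h > 0\<close>
  leaves only the trivial kernel. The determinant is then nonzero, which excludes the value
  \<open>None\<close> of \<open>mat_inverse\<close>.\<close>

lemma resolvent:
  shows V_carrier: "V \<in> carrier_mat p p" and R_V: "R * V = 1\<^sub>m p" and V_R: "V * R = 1\<^sub>m p"
proof -
  have "v = 0\<^sub>v p" if v: "v \<in> carrier_vec p" "R *\<^sub>v v = 0\<^sub>v p" for v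
  proof (rule scalar_prod_self_eq_0[OF v(1)])
    have "(X *\<^sub>v v) \<bullet> (X *\<^sub>v v) + h * (v \<bullet> v) = 0"
      using R_form[OF v(1) v(1)] v by simp
    moreover have "h * (v \<bullet> v) \<ge> 0" using h scalar_prod_self_nonneg[of v] by simp
    ultimately have "h * (v \<bullet> v) = 0" using scalar_prod_self_nonneg[of "X *\<^sub>v v"] by linarith
    thus "v \<bullet> v = 0" using h by simp
  qed
  hence "Determinant.det R \<noteq> 0"
    using det_0_iff_vec_prod_zero_field[OF R_carrier] by blast
  hence "R \<in> Units (ring_mat TYPE(real) p ())" by (rule det_non_zero_imp_unit[OF R_carrier])
  then obtain W where W: "mat_inverse R = Some W"
    using mat_inverse(1)[OF R_carrier, where b = "()"] by (cases "mat_inverse R") auto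
  hence "V = W" by (simp add: ridge_resolvent_def)
  with mat_inverse(2)[OF R_carrier W]
  show "V \<in> carrier_mat p p" "R * V = 1\<^sub>m p" "V * R = 1\<^sub>m p" by auto
qed

lemma V_vec: "x \<in> carrier_vec p \<Longrightarrow> V *\<^sub>v x \<in> carrier_vec p"
  using V_carrier by auto

lemma X_vec: "x \<in> carrier_vec p \<Longrightarrow> X *\<^sub>v x \<in> carrier_vec n"
  using X by auto

lemma Xt_vec: "z \<in> carrier_vec n \<Longrightarrow> transpose_mat X *\<^sub>v z \<in> carrier_vec p"
  using X by auto

lemma Xt_scalar:
  "z \<in> carrier_vec n \<Longrightarrow> x \<in> carrier_vec p \<Longrightarrow> (transpose_mat X *\<^sub>v z) \<bullet> x = z \<bullet> (X *\<^sub>v x)"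
  using transpose_vec_mult_scalar[OF X] by blast

lemma R_V_vec: "x \<in> carrier_vec p \<Longrightarrow> R *\<^sub>v (V *\<^sub>v x) = x"
  using assoc_mult_mat_vec[OF R_carrier V_carrier] by (simp add: R_V)

lemma V_R_vec: "x \<in> carrier_vec p \<Longrightarrow> V *\<^sub>v (R *\<^sub>v x) = x"
  using assoc_mult_mat_vec[OF V_carrier R_carrier] by (simp add: V_R)

text \<open>The equation \<open>R (V x) = x\<close> tested against \<open>y\<close>. Symmetry of
  \<open>V\<close> and all the bounds on it come from particular choices of
  \<open>y\<close>.\<close>

lemma resolvent_form:
  assumes "x \<in> carrier_vec p" "y \<in> carrier_vec p"
  shows "(X *\<^sub>v (V *\<^sub>v x)) \<bullet> (X *\<^sub>v y) + h * ((V *\<^sub>v x) \<bullet> y) = x \<bullet> y"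
  using R_form[OF V_vec[OF assms(1)] assms(2)] assms by (simp add: R_V_vec)

text \<open>Both sides are the form of \<open>R\<close> at the pair \<open>V x\<close>,
  \<open>V y\<close>, and that form is symmetric.\<close>

lemma resolvent_symmetric:
  assumes x: "x \<in> carrier_vec p" and y: "y \<in> carrier_vec p"
  shows "(V *\<^sub>v x) \<bullet> y = x \<bullet> (V *\<^sub>v y)"
proof -
  note c = comm_scalar_prod
  have "(V *\<^sub>v x) \<bullet> y = y \<bullet> (V *\<^sub>v x)" by (rule c[OF V_vec[OF x] y])
  also have "\<dots> = (X *\<^sub>v (V *\<^sub>v y)) \<bullet> (X *\<^sub>v (V *\<^sub>v x)) + h * ((V *\<^sub>v y) \<bullet> (V *\<^sub>v x))"
    by (rule resolvent_form[OF y V_vec[OF x], symmetric])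
  also have "\<dots> = (X *\<^sub>v (V *\<^sub>v x)) \<bullet> (X *\<^sub>v (V *\<^sub>v y)) + h * ((V *\<^sub>v x) \<bullet> (V *\<^sub>v y))"
    using c[OF V_vec[OF x] V_vec[OF y]] c[OF X_vec[OF V_vec[OF x]] X_vec[OF V_vec[OF y]]] by simp
  also have "\<dots> = x \<bullet> (V *\<^sub>v y)" by (rule resolvent_form[OF x V_vec[OF y]])
  finally show ?thesis .
qed

text \<open>For an eigenvalue k of \<open>X' X\<close> this amounts to
  \<open>k / (k + h)\<^sup>2 \<le> 1 / (4 * h)\<close>. No spectral decomposition is involved: the
  square of \<open>l - 2 h V l\<close> is expanded, and the weight \<open>2 * h\<close> is the one
  that reproduces \<open>|X V l|\<^sup>2\<close>.\<close>

lemma variance_bound: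
  assumes l: "l \<in> carrier_vec p"
  shows "(X *\<^sub>v (V *\<^sub>v l)) \<bullet> (X *\<^sub>v (V *\<^sub>v l)) \<le> (l \<bullet> l) / (4 * h)"
proof -
  have "2 * (2 * h) * (l \<bullet> (V *\<^sub>v l)) \<le> l \<bullet> l + (2 * h)\<^sup>2 * ((V *\<^sub>v l) \<bullet> (V *\<^sub>v l))"
    by (rule complete_square[OF l V_vec[OF l]])
  hence "4 * h * (l \<bullet> (V *\<^sub>v l) - h * ((V *\<^sub>v l) \<bullet> (V *\<^sub>v l))) \<le> l \<bullet> l"
    by (simp add: power2_eq_square algebra_simps)
  also have "l \<bullet> (V *\<^sub>v l) - h * ((V *\<^sub>v l) \<bullet> (V *\<^sub>v l)) = (X *\<^sub>v (V *\<^sub>v l)) \<bullet> (X *\<^sub>v (V *\<^sub>v l))"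
    using resolvent_form[OF l V_vec[OF l]] by simp
  finally show ?thesis using h by (simp add: field_simps)
qed

text \<open>Testing with a kernel vector \<open>u\<close> removes the term with \<open>X u\<close>
  and leaves \<open>h (V t \<bullet> u) = t \<bullet> u = 0\<close>.\<close>

lemma resolvent_orth_kernel:
  assumes t: "t \<in> orth_kernel X"
  shows "V *\<^sub>v t \<in> orth_kernel X"
proof -
  have tp: "t \<in> carrier_vec p" using t X by (auto simp: orth_kernel_def)
  have "(V *\<^sub>v t) \<bullet> u = 0" if u: "u \<in> carrier_vec p" "X *\<^sub>v u = 0\<^sub>v n" for u
    using resolvent_form[OF tp u(1)] u t X h X_vec[OF V_vec[OF tp]] by (simp add: orth_kernel_def)
  thus ?thesis using X V_vec[OF tp] by (auto simp: orth_kernel_def)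
qed

text \<open>As \<open>V t\<close> stays orthogonal to the kernel, coercivity applies to it. Both
  bounds go through the number \<open>t \<bullet> V t\<close>, which dominates
  \<open>|X V t|\<^sup>2\<close> and hence \<open>\<mu> |V t|\<^sup>2\<close>. They are free of
  \<open>h\<close>, which scales the bias only from outside.\<close>

lemma bias_bounds:
  assumes t: "t \<in> orth_kernel X" and \<mu>: "\<mu> > 0"
    and coercive: "\<And>v. v \<in> orth_kernel X \<Longrightarrow> \<mu> * (v \<bullet> v) \<le> (X *\<^sub>v v) \<bullet> (X *\<^sub>v v)"
  shows "(V *\<^sub>v t) \<bullet> (V *\<^sub>v t) \<le> (t \<bullet> t) / \<mu>\<^sup>2"
    and "(X *\<^sub>v (V *\<^sub>v t)) \<bullet> (X *\<^sub>v (V *\<^sub>v t)) \<le> (t \<bullet> t) / \<mu>"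
proof -
  have tp: "t \<in> carrier_vec p" using t X by (auto simp: orth_kernel_def)
  define v where "v = V *\<^sub>v t"
  have v: "v \<in> carrier_vec p" unfolding v_def by (rule V_vec[OF tp])
  have form: "(X *\<^sub>v v) \<bullet> (X *\<^sub>v v) + h * (v \<bullet> v) = t \<bullet> v"
    using resolvent_form[OF tp v] by (simp add: v_def)
  have "h * (v \<bullet> v) \<ge> 0" using h scalar_prod_self_nonneg[of v] by simp
  hence Xv: "(X *\<^sub>v v) \<bullet> (X *\<^sub>v v) \<le> t \<bullet> v" using form by simp
  moreover have "\<mu> * (v \<bullet> v) \<le> (X *\<^sub>v v) \<bullet> (X *\<^sub>v v)"
    unfolding v_def by (intro coercive resolvent_orth_kernel t)
  ultimately have vv: "\<mu> * (v \<bullet> v) \<le> t \<bullet> v" by simp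
  \<comment> \<open>The weight \<mu> makes the last term \<mu> times the left side of
    \<open>vv\<close>, so that half of the left side here absorbs it.\<close>
  have sq: "2 * \<mu> * (t \<bullet> v) \<le> t \<bullet> t + \<mu> * (\<mu> * (v \<bullet> v))"
    using complete_square[OF tp v, of \<mu>] by (simp add: power2_eq_square)
  have "\<mu> * (\<mu> * (v \<bullet> v)) \<le> \<mu> * (t \<bullet> v)" using vv \<mu> by (intro mult_left_mono) auto
  with sq have *: "\<mu> * (t \<bullet> v) \<le> t \<bullet> t" "\<mu> * (\<mu> * (v \<bullet> v)) \<le> t \<bullet> t" by linarith+
  show "v \<bullet> v \<le> (t \<bullet> t) / \<mu>\<^sup>2" using *(2) \<mu> by (simp add: power2_eq_square field_simps)
  have "\<mu> * ((X *\<^sub>v v) \<bullet> (X *\<^sub>v v)) \<le> \<mu> * (t \<bullet> v)" using Xv \<mu> by (intro mult_left_mono) auto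
  with *(1) have "\<mu> * ((X *\<^sub>v v) \<bullet> (X *\<^sub>v v)) \<le> t \<bullet> t" by linarith
  thus "(X *\<^sub>v v) \<bullet> (X *\<^sub>v v) \<le> (t \<bullet> t) / \<mu>" using \<mu> by (simp add: field_simps)
qed

text \<open>Testing \<open>x = V X' z\<close> against itself gives
  \<open>|w|\<^sup>2 \<le> z \<bullet> w\<close>, and the completed square with weight 1 does the
  rest.\<close>

lemma hat_matrix_contractive:
  assumes z: "z \<in> carrier_vec n"
  defines "w \<equiv> X *\<^sub>v (V *\<^sub>v (transpose_mat X *\<^sub>v z))"
  shows "w \<bullet> w \<le> z \<bullet> z"
proof -
  define x where "x = V *\<^sub>v (transpose_mat X *\<^sub>v z)"
  have x: "x \<in> carrier_vec p" unfolding x_def by (intro V_vec Xt_vec z)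
  have w: "w \<in> carrier_vec n" "w = X *\<^sub>v x" using X_vec[OF x] by (auto simp: w_def x_def)
  have "w \<bullet> w + h * (x \<bullet> x) = z \<bullet> w"
    using resolvent_form[OF Xt_vec[OF z] x] Xt_scalar[OF z x] by (simp add: w(2) x_def)
  moreover have "h * (x \<bullet> x) \<ge> 0" using h scalar_prod_self_nonneg[of x] by simp
  ultimately have "w \<bullet> w \<le> z \<bullet> w" by simp
  thus ?thesis using complete_square[OF z w(1), of 1] by simp
qed

lemma hat_matrix_symmetric:
  assumes a: "a \<in> carrier_vec n" and b: "b \<in> carrier_vec n"
  shows "(X *\<^sub>v (V *\<^sub>v (transpose_mat X *\<^sub>v a))) \<bullet> b = a \<bullet> (X *\<^sub>v (V *\<^sub>v (transpose_mat X *\<^sub>v b)))"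
proof -
  have "(X *\<^sub>v (V *\<^sub>v (transpose_mat X *\<^sub>v a))) \<bullet> b = b \<bullet> (X *\<^sub>v (V *\<^sub>v (transpose_mat X *\<^sub>v a)))"
    by (intro comm_scalar_prod[of _ n] X_vec V_vec Xt_vec a b)
  also have "\<dots> = (transpose_mat X *\<^sub>v b) \<bullet> (V *\<^sub>v (transpose_mat X *\<^sub>v a))"
    by (intro Xt_scalar[symmetric] V_vec Xt_vec a b)
  also have "\<dots> = (V *\<^sub>v (transpose_mat X *\<^sub>v b)) \<bullet> (transpose_mat X *\<^sub>v a)"
    by (intro resolvent_symmetric[symmetric] Xt_vec a b)
  also have "\<dots> = (transpose_mat X *\<^sub>v a) \<bullet> (V *\<^sub>v (transpose_mat X *\<^sub>v b))"
    by (intro comm_scalar_prod[of _ p] V_vec Xt_vec a b)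
  also have "\<dots> = a \<bullet> (X *\<^sub>v (V *\<^sub>v (transpose_mat X *\<^sub>v b)))"
    by (intro Xt_scalar V_vec Xt_vec a b)
  finally show ?thesis .
qed

lemma ridge_estimator_error:
  assumes t: "t \<in> carrier_vec p" and e: "e \<in> carrier_vec n" and y: "y = X *\<^sub>v t + e"
  shows "ridge_estimator X h y = t + (- h) \<cdot>\<^sub>v (V *\<^sub>v t) + V *\<^sub>v (transpose_mat X *\<^sub>v e)"
proof -
  have "transpose_mat X *\<^sub>v y = transpose_mat X *\<^sub>v (X *\<^sub>v t) + transpose_mat X *\<^sub>v e"
    using X t e unfolding y by (intro mult_add_distrib_mat_vec[of _ p n]) auto
  \<comment> \<open>The term \<open>h t\<close> is added and subtracted: \<open>V\<close> cancels
    \<open>R\<close>, and what remains becomes the bias.\<close>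
  also have "transpose_mat X *\<^sub>v (X *\<^sub>v t) = R *\<^sub>v t + (- h) \<cdot>\<^sub>v t"
    unfolding R_mult_vec[OF t] using t X by (intro eq_vecI) auto
  finally have "ridge_estimator X h y = V *\<^sub>v (R *\<^sub>v t + (- h) \<cdot>\<^sub>v t + transpose_mat X *\<^sub>v e)"
    by (simp add: ridge_estimator_resolvent)
  also have "\<dots> = V *\<^sub>v (R *\<^sub>v t) + V *\<^sub>v ((- h) \<cdot>\<^sub>v t) + V *\<^sub>v (transpose_mat X *\<^sub>v e)"
  proof -
    have "R *\<^sub>v t \<in> carrier_vec p" using R_carrier t by auto
    thus ?thesis using t Xt_vec[OF e] V_carrier
      by (subst mult_add_distrib_mat_vec[of _ p p], auto)+
  qed
  finally show ?thesis using t V_carrier by (simp add: V_R_vec mult_mat_vec[of _ p p])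
qed

end

section \<open>The squared Frobenius norm of the hat matrix\<close>

text \<open>Gram-Schmidt is applied to a maximal independent set of columns, which has as many
  members as the rank. The resulting vectors are orthogonal but not normalized, so Parseval's
  identity carries the divisors \<open>u \<bullet> u\<close>.\<close>

lemma column_space_orthogonal_frame:
  assumes A: "(A :: real mat) \<in> carrier_mat n p"
  shows "\<exists>us. length us = vec_space.rank n A \<and> set us \<subseteq> carrier_vec n \<and>
    (\<forall>u\<in>set us. u \<bullet> u > 0) \<and>
    (\<forall>x\<in>carrier_vec p.
       (A *\<^sub>v x) \<bullet> (A *\<^sub>v x) = (\<Sum>u\<leftarrow>us. (u \<bullet> (A *\<^sub>v x))\<^sup>2 / (u \<bullet> u)))"
proof -
  interpret cof_vec_space n "TYPE(real)" .
  have cols: "set (cols A) \<subseteq> carrier_vec n" using cols_dim[of A] A by auto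
  have "lin_indpt {}"
    by (metis (no_types) empty_subsetI fin_dim finite_basis_exists subset_li_is_li basis_def)
  then obtain S where S: "finite S" "maximal S (\<lambda>T. T \<subseteq> set (cols A) \<and> lin_indpt T)"
    using maximal_exists_superset[of "set (cols A)" "\<lambda>T. T \<subseteq> set (cols A) \<and> lin_indpt T" "{}"]
    by auto
  have S_sub: "S \<subseteq> set (cols A)" and S_li: "lin_indpt S"
    and S_max: "\<And>T. S \<subseteq> T \<Longrightarrow> T \<subseteq> set (cols A) \<Longrightarrow> lin_indpt T \<Longrightarrow> T = S"
    using S(2) by (auto simp: maximal_def)
  have S_carrier: "S \<subseteq> carrier_vec n" using S_sub cols by auto
  have rank: "rank A = card S" by (rule rank_card_indpt[OF A S(2)])
  \<comment> \<open>By maximality: a column outside the span of \<open>S\<close> could be added to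
    \<open>S\<close> without losing independence.\<close>
  have "set (cols A) \<subseteq> span S"
  proof
    fix c assume c: "c \<in> set (cols A)"
    show "c \<in> span S"
    proof (cases "c \<in> S")
      case True
      thus ?thesis using span_mem[OF S_carrier] by auto
    next
      case False
      have "\<not> lin_indpt (S \<union> {c})" using S_max[of "S \<union> {c}"] S_sub c False by auto
      thus ?thesis using lin_dep_iff_in_span[of S c] S_carrier S_li c cols False by auto
    qed
  qed
  hence "span (set (cols A)) \<subseteq> span S"
    by (intro span_is_subset span_is_submodule) (use S_carrier in auto)
  hence col_sub: "col_space A \<subseteq> span S" by (simp add: col_space_def)
  obtain ws where ws: "set ws = S" "distinct ws" using finite_distinct_list[OF S(1)] by auto
  define us where "us = gram_schmidt n ws"
  have "set ws \<subseteq> carrier_vec n" "lin_indpt (set ws)" using ws S_carrier S_li by auto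
  note gs = gram_schmidt_result[OF this(1) ws(2) this(2) us_def]
  have len: "length us = rank A" using gs(4) ws distinct_card rank by metis
  have orth: "us ! i \<bullet> us ! j = 0 \<longleftrightarrow> i \<noteq> j" if "i < length us" "j < length us" for i j
    using corthogonalD[OF gs(2) that] by simp
  have usc: "us ! i \<in> carrier_vec n" if "i < length us" for i using gs(3) that by auto
  have pos: "u \<bullet> u > 0" if "u \<in> set us" for u
  proof -
    obtain i where i: "i < length us" "u = us ! i" using \<open>u \<in> set us\<close> by (auto simp: in_set_conv_nth)
    have "u \<bullet> u \<noteq> 0" using orth[OF i(1) i(1)] i(2) by simp
    thus ?thesis using scalar_prod_self_nonneg[of u] by linarith
  qed
  define U where "U = mat_of_cols n us"
  have U: "U \<in> carrier_mat n (length us)" by (simp add: U_def)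
  have "col_space U = span (set us)" using gs(3) by (simp add: col_space_def U_def)
  hence col_U: "col_space A \<subseteq> col_space U" using col_sub gs(1) ws by simp
  have parseval: "(A *\<^sub>v x) \<bullet> (A *\<^sub>v x) = (\<Sum>u\<leftarrow>us. (u \<bullet> (A *\<^sub>v x))\<^sup>2 / (u \<bullet> u))"
    if x: "x \<in> carrier_vec p" for x
  proof -
    define w where "w = A *\<^sub>v x"
    have "w \<in> col_space A" using A x by (auto simp: col_space_eq[OF A] w_def)
    hence "w \<in> col_space U" using col_U by auto
    then obtain z where z: "z \<in> carrier_vec (length us)" "w = U *\<^sub>v z"
      using U by (auto simp: col_space_eq[OF U])
    have w: "w \<in> carrier_vec n" using U z by auto
    \<comment> \<open>Orthogonality isolates the coefficient of \<open>us ! j\<close> in the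
      expansion of \<open>w\<close>.\<close>
    have inner: "us ! j \<bullet> w = z $ j * (us ! j \<bullet> us ! j)" if j: "j < length us" for j
    proof -
      have "us ! j \<bullet> w = (transpose_mat U *\<^sub>v (us ! j)) \<bullet> z"
        unfolding z(2) by (rule transpose_vec_mult_scalar[OF U z(1) usc[OF j], symmetric])
      also have "transpose_mat U *\<^sub>v (us ! j) = (us ! j \<bullet> us ! j) \<cdot>\<^sub>v unit_vec (length us) j"
      proof (rule eq_vecI)
        fix i assume "i < dim_vec ((us ! j \<bullet> us ! j) \<cdot>\<^sub>v unit_vec (length us) j)"
        hence i: "i < length us" by simp
        have "Matrix.col U i = us ! i" using i usc[OF i] by (simp add: U_def)
        thus "(transpose_mat U *\<^sub>v us ! j) $ i = ((us ! j \<bullet> us ! j) \<cdot>\<^sub>v unit_vec (length us) j) $ i"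
          using i j U orth[OF i j] by auto
      qed (use U in auto)
      finally show ?thesis using z j by simp
    qed
    have "w \<bullet> w = (transpose_mat U *\<^sub>v w) \<bullet> z"
      using transpose_vec_mult_scalar[OF U z(1) w] z(2) by simp
    also have "\<dots> = (\<Sum>j<length us. (us ! j \<bullet> w) * z $ j)"
      using U z usc by (simp add: scalar_prod_def[of _ z] lessThan_atLeast0 U_def)
    also have "\<dots> = (\<Sum>j<length us. (us ! j \<bullet> w)\<^sup>2 / (us ! j \<bullet> us ! j))"
    proof (intro sum.cong refl)
      fix j assume "j \<in> {..<length us}"
      hence j: "j < length us" by simp
      have "us ! j \<bullet> us ! j \<noteq> 0" using pos[of "us ! j"] j by simp
      thus "(us ! j \<bullet> w) * z $ j = (us ! j \<bullet> w)\<^sup>2 / (us ! j \<bullet> us ! j)"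
        by (simp add: inner[OF j] power2_eq_square)
    qed
    also have "\<dots> = (\<Sum>u\<leftarrow>us. (u \<bullet> w)\<^sup>2 / (u \<bullet> u))"
      by (simp add: sum_list_sum_nth lessThan_atLeast0)
    finally show ?thesis by (simp add: w_def)
  qed
  show ?thesis by (intro exI[of _ us] conjI ballI len gs(3) pos parseval)
qed

context ridge
begin

definition hat_matrix :: "real mat" where
  "hat_matrix = X * (V * transpose_mat X)"

lemma hat_matrix_carrier: "hat_matrix \<in> carrier_mat n n"
  using X V_carrier by (auto simp: hat_matrix_def)

lemma hat_matrix_mult_vec:
  assumes "z \<in> carrier_vec n"
  shows "hat_matrix *\<^sub>v z = X *\<^sub>v (V *\<^sub>v (transpose_mat X *\<^sub>v z))"
  using assms X V_carrier unfolding hat_matrix_def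
  by (subst assoc_mult_mat_vec[of _ n p _ n]) (auto simp: assoc_mult_mat_vec[of _ p p _ n])

text \<open>Each column of H = \<open>hat_matrix\<close> lies in the column space of
  \<open>X\<close>, so its squared length is a Parseval sum over the frame. Symmetry moves H onto
  the frame vector \<open>u\<close>; summing over the columns first gives
  \<open>|H u|\<^sup>2 / |u|\<^sup>2\<close>, at most 1 by contractivity, and there are as many such
  terms as the rank.\<close>

lemma hat_matrix_frobenius_le_rank:
  "(\<Sum>k<n. \<Sum>i<n. (hat_matrix $$ (k, i))\<^sup>2) \<le> real (vec_space.rank n X)"
proof -
  obtain us where us: "length us = vec_space.rank n X" "set us \<subseteq> carrier_vec n"
    "\<forall>u\<in>set us. u \<bullet> u > 0"
    "\<forall>x\<in>carrier_vec p.
       (X *\<^sub>v x) \<bullet> (X *\<^sub>v x) = (\<Sum>u\<leftarrow>us. (u \<bullet> (X *\<^sub>v x))\<^sup>2 / (u \<bullet> u))"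
    using column_space_orthogonal_frame[OF X] by (elim exE conjE) (rule that)
  have Hc: "hat_matrix *\<^sub>v z \<in> carrier_vec n" if "z \<in> carrier_vec n" for z
    using that hat_matrix_carrier by auto
  have "(\<Sum>k<n. (hat_matrix $$ (k, i))\<^sup>2) = (\<Sum>u\<leftarrow>us. ((hat_matrix *\<^sub>v u) $ i)\<^sup>2 / (u \<bullet> u))"
    if i: "i < n" for i
  proof -
    define e where "e = (unit_vec n i :: real Matrix.vec)"
    have e: "e \<in> carrier_vec n" by (simp add: e_def)
    have "(\<Sum>k<n. (hat_matrix $$ (k, i))\<^sup>2) = (hat_matrix *\<^sub>v e) \<bullet> (hat_matrix *\<^sub>v e)"
      unfolding scalar_prod_self_sum[OF Hc[OF e]]
      using hat_matrix_carrier i by (simp add: e_def)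
    also have "\<dots> = (\<Sum>u\<leftarrow>us. (u \<bullet> (hat_matrix *\<^sub>v e))\<^sup>2 / (u \<bullet> u))"
      unfolding hat_matrix_mult_vec[OF e] by (intro us(4)[rule_format] V_vec Xt_vec e)
    also have "\<dots> = (\<Sum>u\<leftarrow>us. ((hat_matrix *\<^sub>v u) $ i)\<^sup>2 / (u \<bullet> u))"
    proof (intro arg_cong[where f = sum_list] map_cong refl)
      fix u assume "u \<in> set us"
      hence u: "u \<in> carrier_vec n" using us by auto
      have "u \<bullet> (hat_matrix *\<^sub>v e) = (hat_matrix *\<^sub>v u) \<bullet> e"
        using hat_matrix_symmetric[OF u e] by (simp add: hat_matrix_mult_vec u e)
      also have "\<dots> = (hat_matrix *\<^sub>v u) $ i" using i by (simp add: e_def)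
      finally show "(u \<bullet> (hat_matrix *\<^sub>v e))\<^sup>2 / (u \<bullet> u) = ((hat_matrix *\<^sub>v u) $ i)\<^sup>2 / (u \<bullet> u)"
        by simp
    qed
    finally show ?thesis .
  qed
  hence "(\<Sum>i<n. \<Sum>k<n. (hat_matrix $$ (k, i))\<^sup>2) =
      (\<Sum>i<n. \<Sum>u\<leftarrow>us. ((hat_matrix *\<^sub>v u) $ i)\<^sup>2 / (u \<bullet> u))" by simp
  also have "\<dots> = (\<Sum>u\<leftarrow>us. \<Sum>i<n. ((hat_matrix *\<^sub>v u) $ i)\<^sup>2 / (u \<bullet> u))"
    by (induction us) (simp_all add: sum.distrib)
  also have "\<dots> \<le> (\<Sum>u\<leftarrow>us. 1)"
  proof (rule sum_list_mono)
    fix u assume u: "u \<in> set us"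
    hence uc: "u \<in> carrier_vec n" using us by auto
    have "(\<Sum>i<n. ((hat_matrix *\<^sub>v u) $ i)\<^sup>2 / (u \<bullet> u)) =
        (hat_matrix *\<^sub>v u) \<bullet> (hat_matrix *\<^sub>v u) / (u \<bullet> u)"
      by (simp add: scalar_prod_self_sum[OF Hc[OF uc]] sum_divide_distrib)
    also have "\<dots> \<le> 1"
      using hat_matrix_contractive[OF uc] us(3) u by (simp add: hat_matrix_mult_vec[OF uc])
    finally show "(\<Sum>i<n. ((hat_matrix *\<^sub>v u) $ i)\<^sup>2 / (u \<bullet> u)) \<le> 1" .
  qed
  also have "\<dots> = real (vec_space.rank n X)" using us(1) by (simp add: sum_list_triv)
  finally show ?thesis by (subst sum.swap)
qed

end

section \<open>Second moments of affine forms in independent errors\<close>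

text \<open>In the expanded square the terms linear in the errors have mean zero, and so do products
  of two different errors, by independence. Later \<open>c\<close> is the bias and the
  \<open>a i\<close> are the weights of the noise. Integrability is a conclusion of its own because
  the prediction error is a finite sum of such squares.\<close>

lemma (in prob_space) affine_second_moment:
  fixes e :: "nat \<Rightarrow> 'a \<Rightarrow> real"
  assumes indep: "indep_vars (\<lambda>_. borel) e {..<n}"
    and sq_int: "\<And>i. i < n \<Longrightarrow> integrable M (\<lambda>\<omega>. (e i \<omega>)\<^sup>2)"
    and mean: "\<And>i. i < n \<Longrightarrow> expectation (e i) = 0"
    and var: "\<And>i. i < n \<Longrightarrow> expectation (\<lambda>\<omega>. (e i \<omega>)\<^sup>2) = s"
  shows affine_second_moment_integrable: "integrable M (\<lambda>\<omega>. (c + (\<Sum>i<n. a i * e i \<omega>))\<^sup>2)"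
    and expectation_affine_square:
      "expectation (\<lambda>\<omega>. (c + (\<Sum>i<n. a i * e i \<omega>))\<^sup>2) = c\<^sup>2 + s * (\<Sum>i<n. (a i)\<^sup>2)"
proof -
  have meas: "e i \<in> borel_measurable M" if "i < n" for i
    using indep that by (auto simp: indep_vars_def)
  have int: "integrable M (e i)" if "i < n" for i
    using square_integrable_imp_integrable[OF meas sq_int] that by simp
  have pair: "integrable M (\<lambda>\<omega>. e i \<omega> * e j \<omega>)"
    "expectation (\<lambda>\<omega>. e i \<omega> * e j \<omega>) = (if i = j then s else 0)" if ij: "i < n" "j < n" for i j
  proof -
    have "integrable M (\<lambda>\<omega>. e i \<omega> * e j \<omega>) \<and>
      expectation (\<lambda>\<omega>. e i \<omega> * e j \<omega>) = (if i = j then s else 0)"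
    proof (cases "i = j")
      case True
      thus ?thesis using sq_int[OF ij(1)] var[OF ij(1)] by (simp add: power2_eq_square)
    next
      case False
      have sub: "indep_vars (\<lambda>_. borel) e {i, j}"
        by (rule indep_vars_subset[OF indep]) (use ij in auto)
      have "integrable M (e k)" if "k \<in> {i, j}" for k using that ij int by auto
      note indep_vars_lebesgue_integral[OF _ sub this] indep_vars_integrable[OF _ sub this]
      thus ?thesis using False ij mean by simp
    qed
    thus "integrable M (\<lambda>\<omega>. e i \<omega> * e j \<omega>)"
      "expectation (\<lambda>\<omega>. e i \<omega> * e j \<omega>) = (if i = j then s else 0)" by auto
  qed
  have expand: "(c + (\<Sum>i<n. a i * e i \<omega>))\<^sup>2 =
      c\<^sup>2 + (\<Sum>i<n. 2 * c * a i * e i \<omega>) + (\<Sum>i<n. \<Sum>j<n. a i * a j * (e i \<omega> * e j \<omega>))" for \<omega>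
  proof -
    define S where "S = (\<Sum>i<n. a i * e i \<omega>)"
    have "2 * c * S = (\<Sum>i<n. 2 * c * a i * e i \<omega>)"
      by (simp add: S_def sum_distrib_left mult.assoc)
    moreover have "S * S = (\<Sum>i<n. \<Sum>j<n. a i * a j * (e i \<omega> * e j \<omega>))"
      unfolding S_def sum_product by (simp add: mult_ac)
    ultimately show ?thesis unfolding S_def[symmetric] by (simp add: power2_eq_square algebra_simps)
  qed
  have ints: "integrable M (\<lambda>\<omega>. \<Sum>i<n. 2 * c * a i * e i \<omega>)"
    "integrable M (\<lambda>\<omega>. \<Sum>i<n. \<Sum>j<n. a i * a j * (e i \<omega> * e j \<omega>))"
    using int pair by (auto intro!: Bochner_Integration.integrable_sum integrable_mult_right)
  show "integrable M (\<lambda>\<omega>. (c + (\<Sum>i<n. a i * e i \<omega>))\<^sup>2)"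
    unfolding expand using ints by simp
  have "expectation (\<lambda>\<omega>. (c + (\<Sum>i<n. a i * e i \<omega>))\<^sup>2) = c\<^sup>2
      + expectation (\<lambda>\<omega>. \<Sum>i<n. 2 * c * a i * e i \<omega>)
      + expectation (\<lambda>\<omega>. \<Sum>i<n. \<Sum>j<n. a i * a j * (e i \<omega> * e j \<omega>))"
    unfolding expand using ints by (simp add: prob_space)
  also have "expectation (\<lambda>\<omega>. \<Sum>i<n. 2 * c * a i * e i \<omega>) = 0"
    using int mean by (subst Bochner_Integration.integral_sum) auto
  also have "expectation (\<lambda>\<omega>. \<Sum>i<n. \<Sum>j<n. a i * a j * (e i \<omega> * e j \<omega>)) =
      (\<Sum>i<n. \<Sum>j<n. a i * a j * (if i = j then s else 0))"
    using pair by (subst Bochner_Integration.integral_sum; (intro sum.cong refl)?;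
      (subst Bochner_Integration.integral_sum)?) auto
  also have "\<dots> = s * (\<Sum>i<n. (a i)\<^sup>2)"
    by (simp add: sum_distrib_left power2_eq_square mult_ac if_distrib cong: if_cong)
  finally show "expectation (\<lambda>\<omega>. (c + (\<Sum>i<n. a i * e i \<omega>))\<^sup>2) = c\<^sup>2 + s * (\<Sum>i<n. (a i)\<^sup>2)"
    by simp
qed

section \<open>Exact error formulas for a fixed sample size\<close>

text \<open>One row of the triangular array. The errors enter through independence and their first
  two moments only, with \<open>s\<close> for the variance; their common law reappears in the
  theorem.\<close>

locale ridge_model = ridge X n p h + prob_space M
  for X :: "real mat" and n p :: nat and h :: real and M :: "'w measure" +
  fixes e :: "nat \<Rightarrow> 'w \<Rightarrow> real" and y :: "'w \<Rightarrow> real Matrix.vec"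
    and b t :: "real Matrix.vec" and s :: real
  assumes indep: "indep_vars (\<lambda>_. borel) e {..<n}"
    and sq_int: "\<And>i. i < n \<Longrightarrow> integrable M (\<lambda>\<omega>. (e i \<omega>)\<^sup>2)"
    and mean: "\<And>i. i < n \<Longrightarrow> expectation (e i) = 0"
    and var: "\<And>i. i < n \<Longrightarrow> expectation (\<lambda>\<omega>. (e i \<omega>)\<^sup>2) = s"
    and nonzero: "X \<noteq> 0\<^sub>m n p"
    and b: "b \<in> carrier_vec p"
    and y: "\<And>\<omega>. \<omega> \<in> space M \<Longrightarrow> y \<omega> \<in> carrier_vec n"
    and model: "\<And>\<omega> i. \<omega> \<in> space M \<Longrightarrow> i < n \<Longrightarrow> y \<omega> $ i = Matrix.row X i \<bullet> b + e i \<omega>"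
    and proj: "is_orthogonal_projection (vec_space.row_space p X) b t"
begin

abbreviation "\<mu> \<equiv> min_pos_eigenvalue_gram X"

lemma t_orth_kernel: "t \<in> orth_kernel X"
  using proj row_space_subset_orth_kernel[OF X] by (auto simp: is_orthogonal_projection_def)

lemma t_carrier: "t \<in> carrier_vec p"
  using t_orth_kernel X by (auto simp: orth_kernel_def)

text \<open>Each row of \<open>X\<close> is \<open>X'\<close> applied to a unit vector, hence lies
  in the row space, and \<open>b - t\<close> is orthogonal to it. The observations thus depend on
  \<open>b\<close> only through \<open>t\<close>.\<close>

lemma fitted_values_eq: "X *\<^sub>v b = X *\<^sub>v t"
proof (rule eq_vecI)
  fix i assume "i < dim_vec (X *\<^sub>v t)"
  hence i: "i < n" using X by auto
  have "Matrix.row X i = transpose_mat X *\<^sub>v unit_vec n i"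
    using X i by (intro eq_vecI) auto
  hence "Matrix.row X i \<in> vec_space.row_space p X"
    unfolding vec_space.row_space_eq[OF X] using X i by auto
  hence "(b - t) \<bullet> Matrix.row X i = 0" using proj by (simp add: is_orthogonal_projection_def)
  moreover have row: "Matrix.row X i \<in> carrier_vec p" using X i by auto
  ultimately have "b \<bullet> Matrix.row X i = t \<bullet> Matrix.row X i"
    using b t_carrier by (simp add: minus_scalar_prod_distrib[of _ p])
  thus "(X *\<^sub>v b) $ i = (X *\<^sub>v t) $ i"
    using i X comm_scalar_prod[OF row b] comm_scalar_prod[OF row t_carrier] by simp
qed (use X in auto)

lemma estimator_error:
  assumes "\<omega> \<in> space M"
  shows "ridge_estimator X h (y \<omega>) =
    t + (- h) \<cdot>\<^sub>v (V *\<^sub>v t) + V *\<^sub>v (transpose_mat X *\<^sub>v vec n (\<lambda>i. e i \<omega>))"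
proof (rule ridge_estimator_error[OF t_carrier])
  show "y \<omega> = X *\<^sub>v t + vec n (\<lambda>i. e i \<omega>)"
    unfolding fitted_values_eq[symmetric] using assms y[OF assms] X
    by (intro eq_vecI) (auto simp: model)
qed auto

text \<open>Symmetry of \<open>V\<close> moves the noise operator onto \<open>l\<close>, which
  leaves the weights \<open>X V l\<close> on the errors. Variance and squared bias then separate
  exactly.\<close>

lemma linear_error:
  assumes l: "l \<in> carrier_vec p"
  shows "expectation (\<lambda>\<omega>. (l \<bullet> ridge_estimator X h (y \<omega>) - l \<bullet> t)\<^sup>2) =
    s * ((X *\<^sub>v (V *\<^sub>v l)) \<bullet> (X *\<^sub>v (V *\<^sub>v l))) + h\<^sup>2 * (l \<bullet> (V *\<^sub>v t))\<^sup>2"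
proof -
  define a where "a = X *\<^sub>v (V *\<^sub>v l)"
  have a: "a \<in> carrier_vec n" unfolding a_def by (intro X_vec V_vec l)
  have "l \<bullet> ridge_estimator X h (y \<omega>) - l \<bullet> t = - h * (l \<bullet> (V *\<^sub>v t)) + (\<Sum>i<n. a $ i * e i \<omega>)"
    if \<omega>: "\<omega> \<in> space M" for \<omega>
  proof -
    define \<epsilon> where "\<epsilon> = vec n (\<lambda>i. e i \<omega>)"
    have \<epsilon>: "\<epsilon> \<in> carrier_vec n" by (simp add: \<epsilon>_def)
    note carrier = l t_carrier V_vec[OF t_carrier] V_vec[OF Xt_vec[OF \<epsilon>]]
    have "l \<bullet> (V *\<^sub>v (transpose_mat X *\<^sub>v \<epsilon>)) = (V *\<^sub>v l) \<bullet> (transpose_mat X *\<^sub>v \<epsilon>)"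
      by (rule resolvent_symmetric[OF l Xt_vec[OF \<epsilon>], symmetric])
    also have "\<dots> = (transpose_mat X *\<^sub>v \<epsilon>) \<bullet> (V *\<^sub>v l)"
      by (rule comm_scalar_prod[OF V_vec[OF l] Xt_vec[OF \<epsilon>]])
    also have "\<dots> = \<epsilon> \<bullet> a" unfolding a_def by (rule Xt_scalar[OF \<epsilon> V_vec[OF l]])
    also have "\<dots> = (\<Sum>i<n. a $ i * e i \<omega>)"
      using a by (simp add: scalar_prod_def \<epsilon>_def lessThan_atLeast0 mult.commute)
    finally have noise: "l \<bullet> (V *\<^sub>v (transpose_mat X *\<^sub>v \<epsilon>)) = (\<Sum>i<n. a $ i * e i \<omega>)" .
    show ?thesis
      unfolding estimator_error[OF \<omega>] \<epsilon>_def[symmetric] noise[symmetric] using carrier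
      by (simp add: scalar_prod_add_distrib[of _ p])
  qed
  hence "expectation (\<lambda>\<omega>. (l \<bullet> ridge_estimator X h (y \<omega>) - l \<bullet> t)\<^sup>2) =
      expectation (\<lambda>\<omega>. (- h * (l \<bullet> (V *\<^sub>v t)) + (\<Sum>i<n. a $ i * e i \<omega>))\<^sup>2)"
    by (intro Bochner_Integration.integral_cong) auto
  also have "\<dots> = (- h * (l \<bullet> (V *\<^sub>v t)))\<^sup>2 + s * (\<Sum>i<n. (a $ i)\<^sup>2)"
    by (rule expectation_affine_square[OF indep sq_int mean var])
  finally show ?thesis
    by (simp add: scalar_prod_self_sum[OF a] a_def[symmetric] power_mult_distrib)
qed

text \<open>Coordinate \<open>k\<close> of the error is affine in the noise, with row
  \<open>k\<close> of \<open>hat_matrix\<close> as weights; summing the variances over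
  \<open>k\<close> produces the squared Frobenius norm.\<close>

lemma prediction_error:
  "expectation (\<lambda>\<omega>. (euclid_norm (X *\<^sub>v ridge_estimator X h (y \<omega>) - X *\<^sub>v t))\<^sup>2) =
    s * (\<Sum>k<n. \<Sum>i<n. (hat_matrix $$ (k, i))\<^sup>2) + h\<^sup>2 * ((X *\<^sub>v (V *\<^sub>v t)) \<bullet> (X *\<^sub>v (V *\<^sub>v t)))"
proof -
  define c where "c = X *\<^sub>v (V *\<^sub>v t)"
  have c: "c \<in> carrier_vec n" unfolding c_def by (intro X_vec V_vec t_carrier)
  have "(euclid_norm (X *\<^sub>v ridge_estimator X h (y \<omega>) - X *\<^sub>v t))\<^sup>2 =
      (\<Sum>k<n. (- h * c $ k + (\<Sum>i<n. hat_matrix $$ (k, i) * e i \<omega>))\<^sup>2)"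
    if \<omega>: "\<omega> \<in> space M" for \<omega>
  proof -
    define \<epsilon> where "\<epsilon> = vec n (\<lambda>i. e i \<omega>)"
    have \<epsilon>: "\<epsilon> \<in> carrier_vec n" by (simp add: \<epsilon>_def)
    note carrier = t_carrier V_vec[OF t_carrier] V_vec[OF Xt_vec[OF \<epsilon>]]
    note carrier = carrier carrier[THEN X_vec]
    have "X *\<^sub>v ridge_estimator X h (y \<omega>) = X *\<^sub>v t + (- h) \<cdot>\<^sub>v c + hat_matrix *\<^sub>v \<epsilon>"
      unfolding estimator_error[OF \<omega>] \<epsilon>_def[symmetric] hat_matrix_mult_vec[OF \<epsilon>] c_def
      using carrier by (simp add: mult_add_distrib_mat_vec[OF X] mult_mat_vec[OF X])
    hence "(X *\<^sub>v ridge_estimator X h (y \<omega>) - X *\<^sub>v t) $ k =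
        - h * c $ k + (\<Sum>i<n. hat_matrix $$ (k, i) * e i \<omega>)" if k: "k < n" for k
      using k X c hat_matrix_carrier
      by (simp add: \<epsilon>_def scalar_prod_def lessThan_atLeast0)
    moreover have "X *\<^sub>v ridge_estimator X h (y \<omega>) - X *\<^sub>v t \<in> carrier_vec n"
      using X by (intro carrier_vecI) auto
    ultimately show ?thesis unfolding euclid_norm_sq by (subst scalar_prod_self_sum) auto
  qed
  hence "expectation (\<lambda>\<omega>. (euclid_norm (X *\<^sub>v ridge_estimator X h (y \<omega>) - X *\<^sub>v t))\<^sup>2) =
      expectation (\<lambda>\<omega>. \<Sum>k<n. (- h * c $ k + (\<Sum>i<n. hat_matrix $$ (k, i) * e i \<omega>))\<^sup>2)"
    by (intro Bochner_Integration.integral_cong) auto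
  also have "\<dots> = (\<Sum>k<n. expectation (\<lambda>\<omega>. (- h * c $ k + (\<Sum>i<n. hat_matrix $$ (k, i) * e i \<omega>))\<^sup>2))"
    by (intro Bochner_Integration.integral_sum affine_second_moment_integrable[OF indep sq_int mean var])
  also have "\<dots> = (\<Sum>k<n. (- h * c $ k)\<^sup>2 + s * (\<Sum>i<n. (hat_matrix $$ (k, i))\<^sup>2))"
    by (intro sum.cong refl expectation_affine_square[OF indep sq_int mean var])
  also have "\<dots> = s * (\<Sum>k<n. \<Sum>i<n. (hat_matrix $$ (k, i))\<^sup>2) + h\<^sup>2 * (c \<bullet> c)"
    by (simp add: sum.distrib power_mult_distrib sum_distrib_left scalar_prod_self_sum[OF c])
  finally show ?thesis by (simp add: c_def)
qed

text \<open>The right side is written in the two quantities whose growth the theorem controls, and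
  it is free of \<open>l\<close>.\<close>

lemma linear_bias_le:
  assumes l: "l \<in> carrier_vec p" "euclid_norm l = 1"
  shows "\<bar>h\<^sup>2 * (l \<bullet> (V *\<^sub>v t))\<^sup>2\<bar> \<le> h\<^sup>2 * (euclid_norm t * inverse \<mu>)\<^sup>2"
proof -
  have "l \<bullet> l = 1" using l(2) euclid_norm_sq[of l] by simp
  hence "(l \<bullet> (V *\<^sub>v t))\<^sup>2 \<le> (V *\<^sub>v t) \<bullet> (V *\<^sub>v t)"
    by (rule scalar_prod_unit_sq_le[OF l(1) V_vec[OF t_carrier]])
  also have "\<dots> \<le> (t \<bullet> t) / \<mu>\<^sup>2"
    by (rule bias_bounds(1)[OF t_orth_kernel min_pos_eigenvalue_gram_pos[OF X nonzero]
        min_pos_eigenvalue_gram_le[OF X nonzero]])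
  finally show ?thesis
    by (simp add: euclid_norm_sq power_mult_distrib power_inverse divide_inverse mult_left_mono)
qed

lemma prediction_bias_le:
  "\<bar>h\<^sup>2 * ((X *\<^sub>v (V *\<^sub>v t)) \<bullet> (X *\<^sub>v (V *\<^sub>v t)))\<bar> \<le> h\<^sup>2 * ((euclid_norm t)\<^sup>2 * inverse \<mu>)"
  using bias_bounds(2)[OF t_orth_kernel min_pos_eigenvalue_gram_pos[OF X nonzero]
      min_pos_eigenvalue_gram_le[OF X nonzero]]
  by (simp add: euclid_norm_sq divide_inverse mult_left_mono scalar_prod_self_nonneg)

end

section \<open>Rates along the triangular array\<close>

text \<open>A sum of two O-terms is read as a decomposition into two summands of these orders, with
  equality for every n from 1 on. Variance and squared bias are the summands.\<close>

theorem theorem1: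
  fixes M :: "nat \<Rightarrow> 'w measure"
    and D :: "real measure"
    and eps :: "nat \<Rightarrow> nat \<Rightarrow> 'w \<Rightarrow> real"
    and y :: "nat \<Rightarrow> 'w \<Rightarrow> real Matrix.vec"
    and p r :: "nat \<Rightarrow> nat"
    and X :: "nat \<Rightarrow> real mat"
    and \<beta> \<theta> :: "nat \<Rightarrow> real Matrix.vec"
    and h :: "nat \<Rightarrow> real"
    and \<sigma> \<eta> \<tau> :: real
  assumes prob: "\<And>n. n \<ge> 1 \<Longrightarrow> prob_space (M n)"
    and indep: "\<And>n. n \<ge> 1 \<Longrightarrow> prob_space.indep_vars (M n) (\<lambda>_. borel) (eps n) {..<n}"
    and ident: "\<And>n i. n \<ge> 1 \<Longrightarrow> i < n \<Longrightarrow> distr (M n) borel (eps n i) = D"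
    and square_integrable: "integrable D (\<lambda>x. x\<^sup>2)"
    and mean: "prob_space.expectation D (\<lambda>x. x) = 0"
    and variance: "prob_space.variance D (\<lambda>x. x) = \<sigma>\<^sup>2"
    and X_dim: "\<And>n. n \<ge> 1 \<Longrightarrow> X n \<in> carrier_mat n (p n)"
    and X_nonzero: "\<And>n. n \<ge> 1 \<Longrightarrow> X n \<noteq> 0\<^sub>m n (p n)"
    and \<beta>_dim: "\<And>n. n \<ge> 1 \<Longrightarrow> \<beta> n \<in> carrier_vec (p n)"
    and y_dim: "\<And>n \<omega>. n \<ge> 1 \<Longrightarrow> \<omega> \<in> space (M n) \<Longrightarrow> y n \<omega> \<in> carrier_vec n"
    and model: "\<And>n \<omega> i. n \<ge> 1 \<Longrightarrow> \<omega> \<in> space (M n) \<Longrightarrow> i < n \<Longrightarrow>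
                  vec_index (y n \<omega>) i = scalar_prod (Matrix.row (X n) i) (\<beta> n) + eps n i \<omega>"
    and r_rank: "\<And>n. n \<ge> 1 \<Longrightarrow> r n = vec_space.rank n (X n)"
    and \<theta>_proj: "\<And>n. n \<ge> 1 \<Longrightarrow>
                  is_orthogonal_projection (vec_space.row_space (p n) (X n)) (\<beta> n) (\<theta> n)"
    and h_pos: "\<And>n. n \<ge> 1 \<Longrightarrow> h n > 0"
    and \<eta>: "\<eta> \<le> 1"
    and eigenvalue_rate:
      "(\<lambda>n. inverse (min_pos_eigenvalue_gram (X n))) \<in> O(\<lambda>n. real n powr (- \<eta>))"
    and \<tau>: "\<tau> < \<eta>"
    and \<theta>_rate: "(\<lambda>n. euclid_norm (\<theta> n)) \<in> O(\<lambda>n. real n powr \<tau>)"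
  shows
    "(\<exists>a b :: nat \<Rightarrow> real Matrix.vec \<Rightarrow> real.
        uniform_bigo (\<lambda>n. {l \<in> carrier_vec (p n). euclid_norm l = 1}) a (\<lambda>n. inverse (h n)) \<and>
        uniform_bigo (\<lambda>n. {l \<in> carrier_vec (p n). euclid_norm l = 1}) b
          (\<lambda>n. (h n)\<^sup>2 * real n powr (- 2 * (\<eta> - \<tau>))) \<and>
        (\<forall>n\<ge>1. \<forall>l\<in>carrier_vec (p n). euclid_norm l = 1 \<longrightarrow>
           prob_space.expectation (M n) (\<lambda>\<omega>.
             (scalar_prod l (ridge_estimator (X n) (h n) (y n \<omega>)) - scalar_prod l (\<theta> n))\<^sup>2)
           = a n l + b n l))
     \<and>
     (\<exists>a b :: nat \<Rightarrow> real.
        a \<in> O(\<lambda>n. real (r n) / real n) \<and>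
        b \<in> O(\<lambda>n. (h n)\<^sup>2 * real n powr (- (1 + \<eta> - 2 * \<tau>))) \<and>
        (\<forall>n\<ge>1.
           prob_space.expectation (M n) (\<lambda>\<omega>.
             (euclid_norm (X n *\<^sub>v ridge_estimator (X n) (h n) (y n \<omega>) - X n *\<^sub>v \<theta> n))\<^sup>2) / real n
           = a n + b n))"
proof -
  have model_n: "ridge_model (X n) n (p n) (h n) (M n) (eps n) (y n) (\<beta> n) (\<theta> n) (\<sigma>\<^sup>2)"
    if n: "n \<ge> 1" for n
  proof -
    interpret prob_space "M n" by (rule prob[OF n])
    have meas: "eps n i \<in> borel_measurable (M n)" if "i < n" for i
      using indep[OF n] that by (auto simp: indep_vars_def)
    have "integrable (M n) (\<lambda>\<omega>. (eps n i \<omega>)\<^sup>2)" if i: "i < n" for i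
      using square_integrable unfolding ident[OF n i, symmetric]
      by (simp add: integrable_distr_eq[OF meas[OF i]])
    moreover have "expectation (eps n i) = 0" if i: "i < n" for i
      using mean unfolding ident[OF n i, symmetric] by (simp add: integral_distr[OF meas[OF i]])
    \<comment> \<open>As the mean is zero, the variance of \<open>D\<close> is its plain second
      moment, which is then transported to the error.\<close>
    moreover have "expectation (\<lambda>\<omega>. (eps n i \<omega>)\<^sup>2) = \<sigma>\<^sup>2" if i: "i < n" for i
      using variance unfolding mean diff_0_right unfolding ident[OF n i, symmetric]
      by (simp add: integral_distr[OF meas[OF i]])
    ultimately show ?thesis
      using n by unfold_locales
        (auto intro!: X_dim h_pos indep X_nonzero \<beta>_dim y_dim model \<theta>_proj)
  qed
  have ridge_n: "ridge (X n) n (p n) (h n)" if "n \<ge> 1" for n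
    using model_n[OF that] by (simp add: ridge_model_def)
  obtain C\<^sub>1 where C\<^sub>1: "C\<^sub>1 > 0" and ev\<^sub>1: "eventually (\<lambda>n.
      norm (inverse (min_pos_eigenvalue_gram (X n))) \<le> C\<^sub>1 * norm (real n powr (- \<eta>))) sequentially"
    using eigenvalue_rate by (rule landau_o.bigE)
  obtain C\<^sub>2 where C\<^sub>2: "C\<^sub>2 > 0" and ev\<^sub>2: "eventually (\<lambda>n.
      norm (euclid_norm (\<theta> n)) \<le> C\<^sub>2 * norm (real n powr \<tau>)) sequentially"
    using \<theta>_rate by (rule landau_o.bigE)
  have bounds: "eventually (\<lambda>n. n \<ge> 1 \<and>
      \<bar>inverse (min_pos_eigenvalue_gram (X n))\<bar> \<le> C\<^sub>1 * real n powr (- \<eta>) \<and>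
      \<bar>euclid_norm (\<theta> n)\<bar> \<le> C\<^sub>2 * real n powr \<tau>) sequentially"
    using ev\<^sub>1 ev\<^sub>2 eventually_ge_at_top[of 1] by eventually_elim auto
  let ?S = "\<lambda>n. {l \<in> carrier_vec (p n). euclid_norm l = 1}"
  let ?V = "\<lambda>n. ridge_resolvent (X n) (h n)"
  let ?H = "\<lambda>n. ridge.hat_matrix (X n) (h n)"
  \<comment> \<open>The witnesses: \<open>a\<close> and \<open>a'\<close> are the variance parts,
    \<open>b\<close> and \<open>b'\<close> the squared biases.\<close>
  define a where "a n l = \<sigma>\<^sup>2 * ((X n *\<^sub>v (?V n *\<^sub>v l)) \<bullet> (X n *\<^sub>v (?V n *\<^sub>v l)))" for n l
  define b where "b n l = (h n)\<^sup>2 * (l \<bullet> (?V n *\<^sub>v \<theta> n))\<^sup>2" for n l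
  define a' where "a' n = \<sigma>\<^sup>2 * (\<Sum>k<n. \<Sum>i<n. (?H n $$ (k, i))\<^sup>2) / real n" for n
  define b' where
    "b' n = (h n)\<^sup>2 * ((X n *\<^sub>v (?V n *\<^sub>v \<theta> n)) \<bullet> (X n *\<^sub>v (?V n *\<^sub>v \<theta> n))) / real n" for n
  \<comment> \<open>The constant is \<open>\<sigma>\<^sup>2 + 1\<close> because it has to be
    positive even if \<sigma> is zero. The threshold 1 suffices, since the variance bound is not
    asymptotic.\<close>
  have a: "uniform_bigo ?S a (\<lambda>n. inverse (h n))"
    unfolding uniform_bigo_def
  proof (intro exI[of _ "\<sigma>\<^sup>2 + 1"] conjI eventually_sequentiallyI[of 1] ballI)
    fix n :: nat and l assume n: "1 \<le> n" and l: "l \<in> ?S n"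
    have h: "h n > 0" by (rule h_pos[OF n])
    have ll: "l \<bullet> l = 1" using l euclid_norm_sq[of l] by simp
    have "(X n *\<^sub>v (?V n *\<^sub>v l)) \<bullet> (X n *\<^sub>v (?V n *\<^sub>v l)) \<le> 1 / (4 * h n)"
      using ridge.variance_bound[OF ridge_n[OF n], of l] l ll by simp
    also have "\<dots> \<le> inverse (h n)" using h by (simp add: field_simps)
    finally have "\<bar>a n l\<bar> \<le> \<sigma>\<^sup>2 * inverse (h n)"
      by (simp add: a_def abs_mult scalar_prod_self_nonneg mult_left_mono)
    also have "\<dots> \<le> (\<sigma>\<^sup>2 + 1) * \<bar>inverse (h n)\<bar>" using h by (intro mult_mono) auto
    finally show "\<bar>a n l\<bar> \<le> (\<sigma>\<^sup>2 + 1) * \<bar>inverse (h n)\<bar>" .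
  qed (simp add: add_nonneg_pos)
  have b: "uniform_bigo ?S b (\<lambda>n. (h n)\<^sup>2 * real n powr (- 2 * (\<eta> - \<tau>)))"
    unfolding uniform_bigo_def
  proof (intro exI[of _ "(C\<^sub>2 * C\<^sub>1)\<^sup>2"] conjI)
    show "eventually (\<lambda>n. \<forall>l\<in>?S n.
        \<bar>b n l\<bar> \<le> (C\<^sub>2 * C\<^sub>1)\<^sup>2 * \<bar>(h n)\<^sup>2 * real n powr (- 2 * (\<eta> - \<tau>))\<bar>) sequentially"
      using bounds
    proof eventually_elim
      case (elim n)
      let ?t = "euclid_norm (\<theta> n)" and ?i = "inverse (min_pos_eigenvalue_gram (X n))"
      have "\<bar>?t * ?i\<bar> \<le> (C\<^sub>2 * real n powr \<tau>) * (C\<^sub>1 * real n powr (- \<eta>))"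
        unfolding abs_mult using elim C\<^sub>1 C\<^sub>2 by (intro mult_mono) auto
      hence "(?t * ?i)\<^sup>2 \<le> ((C\<^sub>2 * real n powr \<tau>) * (C\<^sub>1 * real n powr (- \<eta>)))\<^sup>2"
        by (metis abs_ge_zero power2_abs power_mono)
      also have "\<dots> = (C\<^sub>2 * C\<^sub>1)\<^sup>2 * (real n powr (\<tau> + - \<eta>))\<^sup>2"
        unfolding powr_add by (simp add: power_mult_distrib mult_ac)
      also have "(real n powr (\<tau> + - \<eta>))\<^sup>2 = real n powr (- 2 * (\<eta> - \<tau>))"
        by (simp add: power2_eq_square powr_add[symmetric] algebra_simps)
      finally have sq: "(?t * ?i)\<^sup>2 \<le> (C\<^sub>2 * C\<^sub>1)\<^sup>2 * real n powr (- 2 * (\<eta> - \<tau>))" .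
      have "(h n)\<^sup>2 * (?t * ?i)\<^sup>2 \<le> (C\<^sub>2 * C\<^sub>1)\<^sup>2 * \<bar>(h n)\<^sup>2 * real n powr (- 2 * (\<eta> - \<tau>))\<bar>"
        using mult_left_mono[OF sq, of "(h n)\<^sup>2"] by (simp add: mult_ac)
      \<comment> \<open>No \<open>l\<close> occurs on the right, which is the required
        uniformity.\<close>
      moreover have "\<bar>b n l\<bar> \<le> (h n)\<^sup>2 * (?t * ?i)\<^sup>2" if "l \<in> ?S n" for l
        unfolding b_def using that elim by (intro ridge_model.linear_bias_le[OF model_n]) auto
      ultimately show ?case by (blast intro: order_trans)
    qed
  qed (use C\<^sub>1 C\<^sub>2 in simp)
  have a': "a' \<in> O(\<lambda>n. real (r n) / real n)"
  proof (intro landau_o.bigI[of "\<sigma>\<^sup>2 + 1"] eventually_sequentiallyI[of 1])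
    fix n :: nat assume n: "1 \<le> n"
    let ?F = "\<Sum>k<n. \<Sum>i<n. (?H n $$ (k, i))\<^sup>2"
    have "?F \<ge> 0" by (intro sum_nonneg) auto
    moreover have "?F \<le> real (r n)"
      unfolding r_rank[OF n] by (rule ridge.hat_matrix_frobenius_le_rank[OF ridge_n[OF n]])
    ultimately have "\<sigma>\<^sup>2 * ?F \<le> (\<sigma>\<^sup>2 + 1) * real (r n)" "0 \<le> \<sigma>\<^sup>2 * ?F" by (auto intro!: mult_mono)
    thus "norm (a' n) \<le> (\<sigma>\<^sup>2 + 1) * norm (real (r n) / real n)"
      by (simp add: a'_def divide_right_mono)
  qed (simp add: add_nonneg_pos)
  have b': "b' \<in> O(\<lambda>n. (h n)\<^sup>2 * real n powr (- (1 + \<eta> - 2 * \<tau>)))"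
  proof (intro landau_o.bigI[of "C\<^sub>2\<^sup>2 * C\<^sub>1"])
    show "eventually (\<lambda>n. norm (b' n) \<le>
        C\<^sub>2\<^sup>2 * C\<^sub>1 * norm ((h n)\<^sup>2 * real n powr (- (1 + \<eta> - 2 * \<tau>)))) sequentially"
      using bounds
    proof eventually_elim
      case (elim n)
      let ?t = "euclid_norm (\<theta> n)" and ?i = "inverse (min_pos_eigenvalue_gram (X n))"
      have n: "real n > 0" using elim by simp
      have "?t\<^sup>2 \<le> (C\<^sub>2 * real n powr \<tau>)\<^sup>2" using elim by (metis abs_ge_zero power2_abs power_mono)
      moreover have "?i > 0" using min_pos_eigenvalue_gram_pos[OF X_dim X_nonzero] elim by simp
      ultimately have "?t\<^sup>2 * ?i \<le> (C\<^sub>2 * real n powr \<tau>)\<^sup>2 * (C\<^sub>1 * real n powr (- \<eta>))"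
        using elim by (intro mult_mono) auto
      hence "?t\<^sup>2 * ?i / real n \<le> (C\<^sub>2 * real n powr \<tau>)\<^sup>2 * (C\<^sub>1 * real n powr (- \<eta>)) / real n"
        using n by (simp add: divide_right_mono)
      \<comment> \<open>Division by n contributes the exponent -1, for a total of 2 \<tau> - \<eta>
        - 1.\<close>
      also have "\<dots> = C\<^sub>2\<^sup>2 * C\<^sub>1 * (real n powr \<tau> * real n powr \<tau> * real n powr (- \<eta>) * real n powr (- 1))"
        using n by (simp add: power2_eq_square powr_minus_divide)
      also have "\<dots> = C\<^sub>2\<^sup>2 * C\<^sub>1 * real n powr (- (1 + \<eta> - 2 * \<tau>))"
        unfolding powr_add[symmetric] by (simp add: algebra_simps)
      finally have le: "?t\<^sup>2 * ?i / real n \<le> C\<^sub>2\<^sup>2 * C\<^sub>1 * real n powr (- (1 + \<eta> - 2 * \<tau>))" .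
      have "norm (b' n) \<le> (h n)\<^sup>2 * (?t\<^sup>2 * ?i) / real n"
        using ridge_model.prediction_bias_le[OF model_n, of n] elim n
        by (simp add: b'_def divide_right_mono)
      also have "\<dots> \<le> C\<^sub>2\<^sup>2 * C\<^sub>1 * norm ((h n)\<^sup>2 * real n powr (- (1 + \<eta> - 2 * \<tau>)))"
        using mult_left_mono[OF le, of "(h n)\<^sup>2"] by (simp add: mult_ac)
      finally show ?case .
    qed
  qed (use C\<^sub>1 C\<^sub>2 in simp)
  have ab: "\<forall>n\<ge>1. \<forall>l\<in>carrier_vec (p n). euclid_norm l = 1 \<longrightarrow>
      prob_space.expectation (M n) (\<lambda>\<omega>.
        (l \<bullet> ridge_estimator (X n) (h n) (y n \<omega>) - l \<bullet> \<theta> n)\<^sup>2) = a n l + b n l"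
    unfolding a_def b_def
    by (intro allI impI ballI ridge_model.linear_error[OF model_n])
  have ab': "\<forall>n\<ge>1. prob_space.expectation (M n) (\<lambda>\<omega>.
        (euclid_norm (X n *\<^sub>v ridge_estimator (X n) (h n) (y n \<omega>) - X n *\<^sub>v \<theta> n))\<^sup>2) / real n =
      a' n + b' n"
    unfolding a'_def b'_def
    by (simp add: ridge_model.prediction_error[OF model_n] add_divide_distrib)
  show ?thesis
    by (rule conjI, rule exI[of _ a], rule exI[of _ b], intro conjI a b ab,
        rule exI[of _ a'], rule exI[of _ b'], intro conjI a' b' ab')
qed

end
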